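(* Let $\mathcal{A}=(a_i)_{i=1}^\infty$ be a weakly increasing sequence of positive integers, $k$ a positive integer, and $\alpha$ a positive real number. The sequence $\left(p_\mathcal{A}(n,k)/n^\alpha\right)_{n\ge1}$ is eventually log-concave, i.e. there is $N$ such that $$\left(\frac{p_\mathcal{A}(n,k)}{n^\alpha}\right)^2>\frac{p_\mathcal{A}(n+1,k)}{(n+1)^\alpha}\cdot\frac{p_\mathcal{A}(n-1,k)}{(n-1)^\alpha}\quad\text{for all } n\geq N,$$ if and only if $k>\alpha+1$ and either $2\leq k\leq 3$ and $a_1=\cdots=a_k=1$, or $k\geq 4$ and $\gcd A=1$ for all $(k-2)$-multisubsets $A$ of $\{a_1,\ldots,a_k\}$.
   Context: For a weakly increasing sequence $\mathcal{A}=(a_i)_{i\ge1}$ of positive integers and a positive integer $k$, the restricted partition function $p_\mathcal{A}(n,k)$ is defined by $\sum_{n\ge0}p_\mathcal{A}(n,k)x^n=\prod_{i=1}^k(1-x^{a_i})^{-1}$; equivalently, it counts the partitions of $n$ whose parts lie in the multiset $\{a_1,\ldots,a_k\}$ (equal values with different indices count as distinct colors). A $j$-multisubset of $\{a_1,\ldots,a_k\}$ is a sub-multiset obtained by choosing $j$ of the $k$ indices. *)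

theory Defs
  imports "HOL-Analysis.Analysis"
begin

text \<open>Restricted partition function p_A(n,k): the number of ways to write
  n = c_1 a_1 + ... + c_k a_k with multiplicities c_i in nat, i.e. the coefficient
  of x^n in prod_{i=1..k} (1 - x^(a_i))^(-1). Index i ranges over {1..k} (colours
  distinguished by index).\<close>
definition restricted_partition :: "(nat \<Rightarrow> nat) \<Rightarrow> nat \<Rightarrow> nat \<Rightarrow> nat" where
  "restricted_partition a n k =
     card {c \<in> {1..k} \<rightarrow>\<^sub>E (UNIV :: nat set). (\<Sum>i\<in>{1..k}. c i * a i) = n}"

end

(* The function p(n) = p_A(n,k) is a quasi-polynomial: p(n) = sum_j c_j(n) n^j with periodic c_j.
   The recursion p_A(n) - p_A(n - a_i) = p_(A without a_i)(n) shows, by downward induction on j, that c_j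
   has every a_i as a period; hence c_j is constant as soon as no d >= 2 divides more than j of the a_i.
   After division by n^(k-1), log-concavity of p(n)/n^alpha is governed by
     u(n)^2 - u(n+1) u(n-1) > (-(k-1-alpha) + o(1)) u(n)^2 / n^2,
   where u(n) = c_(k-1) + c_(k-2)/n + c_(k-3)/n^2 + O(n^-3). If these three coefficients are constant, the
   left-hand side is o(n^-2) and alpha < k - 1 suffices. Conversely, log-concavity forces positivity,
   so c_(k-1) is constant; then c_(k-2) has nonpositive second differences, so it is constant;
   and the second differences of c_(k-3) are at most (k-1-alpha) c_(k-1), which excludes a prime dividing
   exactly k - 2 of the a_i by an integrality argument. Finally, if alpha >= k - 1, then u increases to its limit
   c_(k-1), and summing p(m) <= c_(k-1) m^(k-1) contradicts the lower bound
   (n+1)^k / (k! a_1 ... a_k) for the sum of p(m) over m <= n. *)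

theory Submission
  imports Defs "HOL-Real_Asymp.Real_Asymp"
begin

subsection \<open>Counting partitions with parts indexed by a finite set\<close>

text \<open>Parts are removed one at a time, so counting is set up for an arbitrary finite index
  set. Three coefficients matter because \<alpha> enters only at relative order n^-2: the powers
  contribute (n (n + 2) / (n + 1)^2)^(k-1-\<alpha>), which is 1 - (k-1-\<alpha>)/n^2 up to higher
  order. So c_(k-2) meets a condition free of \<alpha>, while c_(k-3) meets a one-sided bound with
  slack, and concavity alone cannot make it constant. The obstacle is a prime q dividing all parts
  but a_i and a_j. Then the mixed difference of c_(k-3) with steps a_i, a_j is -K off one class
  modulo q, where K = c_(k-1) (k-1)(k-2) a_i a_j. After averaging over the classes modulo q, second
  differences become integer multiples of K, and \<alpha> > 0 puts the permitted bound strictly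
  below K. For \<alpha> \<ge> k-1 and k \<ge> 2 the contradiction sits in the second-order term: the
  sum of m^(k-1) over m \<le> n is n^k/k + n^(k-1)/2 + ..., whereas (n+1)^k/k is n^k/k + n^(k-1) +
  ....\<close>

definition part_count :: "('i \<Rightarrow> nat) \<Rightarrow> 'i set \<Rightarrow> nat \<Rightarrow> nat" where
  "part_count a I n = card {c \<in> I \<rightarrow>\<^sub>E UNIV. (\<Sum>i\<in>I. c i * a i) = n}"

lemma restricted_partition_eq_part_count:
  "restricted_partition a n k = part_count a {1..k} n"
  by (simp add: restricted_partition_def part_count_def)

lemma finite_part_count_set:
  assumes "finite I" "\<And>i. i \<in> I \<Longrightarrow> a i > 0"
  shows "finite {c \<in> I \<rightarrow>\<^sub>E (UNIV :: nat set). (\<Sum>i\<in>I. c i * a i) = n}"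
proof (rule finite_subset)
  show "{c \<in> I \<rightarrow>\<^sub>E UNIV. (\<Sum>i\<in>I. c i * a i) = n} \<subseteq> I \<rightarrow>\<^sub>E {..n}"
  proof
    fix c assume c: "c \<in> {c \<in> I \<rightarrow>\<^sub>E UNIV. (\<Sum>i\<in>I. c i * a i) = n}"
    have "c i \<le> n" if "i \<in> I" for i
    proof -
      have "c i \<le> c i * a i" using assms(2)[OF that] by simp
      also have "\<dots> \<le> (\<Sum>i\<in>I. c i * a i)" using assms(1) that by (intro member_le_sum) auto
      finally show ?thesis using c by simp
    qed
    then show "c \<in> I \<rightarrow>\<^sub>E {..n}" using c by (auto simp: PiE_iff)
  qed
  show "finite (I \<rightarrow>\<^sub>E {..n})" using assms(1) by (intro finite_PiE) auto
qed

lemma part_count_empty: "part_count a {} n = (if n = 0 then 1 else 0)"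
  by (auto simp: part_count_def)

lemma part_count_zero_multiplicity:
  assumes "finite I" "i \<notin> I"
  shows "card {c \<in> insert i I \<rightarrow>\<^sub>E UNIV. (\<Sum>j\<in>insert i I. c j * a j) = n \<and> c i = 0} = part_count a I n"
proof -
  let ?A = "{c \<in> insert i I \<rightarrow>\<^sub>E UNIV. (\<Sum>j\<in>insert i I. c j * a j) = n \<and> c i = 0}"
  let ?B = "{c \<in> I \<rightarrow>\<^sub>E UNIV. (\<Sum>i\<in>I. c i * a i) = n}"
  have s: "(\<Sum>j\<in>I. (if j = i then v else c j) * a j) = (\<Sum>j\<in>I. c j * a j)" for c v
    using assms(2) by (intro sum.cong) auto
  have "bij_betw (\<lambda>c. c(i := undefined)) ?A ?B"
  proof (rule bij_betw_byWitness[where f' = "\<lambda>c. c(i := 0)"])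
    show "\<forall>c\<in>?A. (c(i := undefined))(i := 0) = c" by auto
    show "\<forall>c\<in>?B. (c(i := 0))(i := undefined) = c" using assms(2) by (auto simp: PiE_def extensional_def)
    show "(\<lambda>c. c(i := undefined)) ` ?A \<subseteq> ?B"
    proof (rule image_subsetI)
      fix c assume "c \<in> ?A"
      then show "c(i := undefined) \<in> ?B"
        using assms s[where c = c and v = "undefined"] by (auto simp: PiE_iff extensional_def)
    qed
    show "(\<lambda>c. c(i := 0)) ` ?B \<subseteq> ?A"
    proof (rule image_subsetI)
      fix c assume "c \<in> ?B"
      then show "c(i := 0) \<in> ?A"
        using assms s[where c = c and v = "0"] by (auto simp: PiE_iff extensional_def)
    qed
  qed
  then show ?thesis unfolding part_count_def by (rule bij_betw_same_card)
qed

lemma part_count_insert_less: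
  assumes "finite I" "i \<notin> I" "n < a i"
  shows "part_count a (insert i I) n = part_count a I n"
proof -
  have "c i = 0" if "(\<Sum>j\<in>insert i I. c j * a j) = n" for c
    using that assms by (cases "c i") auto
  then have "{c \<in> insert i I \<rightarrow>\<^sub>E UNIV. (\<Sum>j\<in>insert i I. c j * a j) = n}
      = {c \<in> insert i I \<rightarrow>\<^sub>E UNIV. (\<Sum>j\<in>insert i I. c j * a j) = n \<and> c i = 0}" by blast
  then show ?thesis
    using part_count_zero_multiplicity[OF assms(1,2)] by (simp add: part_count_def)
qed

text \<open>Solutions that use \<open>i\<close> lose one copy of it, the others do not involve
  \<open>i\<close>. Stating this at \<open>n + a i\<close> avoids truncated subtraction.\<close>

lemma part_count_insert_add:
  assumes "finite I" "i \<notin> I" "\<And>j. j \<in> insert i I \<Longrightarrow> a j > 0"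
  shows "part_count a (insert i I) (n + a i) = part_count a (insert i I) n + part_count a I (n + a i)"
proof -
  let ?A = "{c \<in> insert i I \<rightarrow>\<^sub>E UNIV. (\<Sum>j\<in>insert i I. c j * a j) = n + a i}"
  let ?Z = "{c \<in> insert i I \<rightarrow>\<^sub>E UNIV. (\<Sum>j\<in>insert i I. c j * a j) = n + a i \<and> c i = 0}"
  let ?P = "{c \<in> insert i I \<rightarrow>\<^sub>E UNIV. (\<Sum>j\<in>insert i I. c j * a j) = n + a i \<and> c i > 0}"
  let ?B = "{c \<in> insert i I \<rightarrow>\<^sub>E UNIV. (\<Sum>j\<in>insert i I. c j * a j) = n}"
  have fA: "finite ?A" using assms by (intro finite_part_count_set) auto
  have s: "(\<Sum>j\<in>I. (if j = i then v else c j) * a j) = (\<Sum>j\<in>I. c j * a j)" for c v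
    using assms(2) by (intro sum.cong) auto
  have "bij_betw (\<lambda>c. c(i := c i - 1)) ?P ?B"
  proof (rule bij_betw_byWitness[where f' = "\<lambda>c. c(i := c i + 1)"])
    show "\<forall>c\<in>?P. (c(i := c i - 1))(i := (c(i := c i - 1)) i + 1) = c" by auto
    show "\<forall>c\<in>?B. (c(i := c i + 1))(i := (c(i := c i + 1)) i - 1) = c" by auto
    show "(\<lambda>c. c(i := c i - 1)) ` ?P \<subseteq> ?B"
    proof (rule image_subsetI)
      fix c assume c: "c \<in> ?P"
      then obtain m where m: "c i = Suc m" using gr0_implies_Suc by blast
      then show "c(i := c i - 1) \<in> ?B" using assms(1,2) c s[where c = c and v = m]
        by (auto simp: PiE_iff extensional_def)
    qed
    show "(\<lambda>c. c(i := c i + 1)) ` ?B \<subseteq> ?P"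
    proof (rule image_subsetI)
      fix c assume "c \<in> ?B"
      then show "c(i := c i + 1) \<in> ?P"
        using assms(1,2) s[where c = c and v = "Suc (c i)"] by (auto simp: PiE_iff extensional_def)
    qed
  qed
  then have P: "card ?P = part_count a (insert i I) n"
    unfolding part_count_def by (rule bij_betw_same_card)
  have "?A = ?Z \<union> ?P" by auto
  moreover have "finite ?Z" "finite ?P"
    by (rule finite_subset[OF _ fA], blast)+
  moreover have "?Z \<inter> ?P = {}" by auto
  ultimately have "card ?A = card ?Z + card ?P" by (simp only: card_Un_disjoint)
  then show ?thesis
    using P part_count_zero_multiplicity[OF assms(1,2), of a "n + a i"] by (simp add: part_count_def)
qed

lemma part_count_eq_0_if_not_dvd:
  assumes "\<And>i. i \<in> I \<Longrightarrow> d dvd a i" "\<not> d dvd n"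
  shows "part_count a I n = 0"
proof -
  have "{c \<in> I \<rightarrow>\<^sub>E UNIV. (\<Sum>i\<in>I. c i * a i) = n} = {}"
    using assms by (auto intro!: dvd_sum)
  then show ?thesis by (simp only: part_count_def card.empty)
qed

section \<open>A volume lower bound for cumulative counts\<close>

lemma power_diff_le:
  fixes x a :: real
  assumes "0 \<le> a" "a \<le> x"
  shows "x ^ Suc m - (x - a) ^ Suc m \<le> real (Suc m) * a * x ^ m"
proof -
  have eq: "x ^ Suc m - (x - a) ^ Suc m = a * (\<Sum>p<Suc m. x ^ p * (x - a) ^ (m - p))"
    using diff_power_eq_sum[of x m "x - a"] by simp
  have "(\<Sum>p<Suc m. x ^ p * (x - a) ^ (m - p)) \<le> (\<Sum>p<Suc m. x ^ m)"
  proof (rule sum_mono)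
    fix p assume "p \<in> {..<Suc m}"
    have "x ^ p * (x - a) ^ (m - p) \<le> x ^ p * x ^ (m - p)"
      using assms by (intro mult_left_mono power_mono) auto
    also have "\<dots> = x ^ m" using \<open>p \<in> {..<Suc m}\<close> by (simp flip: power_add)
    finally show "x ^ p * (x - a) ^ (m - p) \<le> x ^ m" .
  qed
  then have "(\<Sum>p<Suc m. x ^ p * (x - a) ^ (m - p)) \<le> real (Suc m) * x ^ m" by simp
  from mult_left_mono[OF this assms(1)] show ?thesis unfolding eq by (simp only: ac_simps)
qed

lemma sum_part_count_insert:
  assumes "finite I" "i \<notin> I" "\<And>j. j \<in> insert i I \<Longrightarrow> a j > 0"
  shows "(\<Sum>m\<le>n. part_count a (insert i I) m) =
    (\<Sum>m\<le>n. part_count a I m) + (if a i \<le> n then \<Sum>m\<le>n - a i. part_count a (insert i I) m else 0)"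
proof (induction n)
  case 0
  then show ?case using part_count_insert_less[of I i 0 a] assms(1,2) assms(3)[of i] by simp
next
  case (Suc n)
  show ?case
  proof (cases "Suc n < a i")
    case True
    then show ?thesis using Suc part_count_insert_less[of I i "Suc n" a] assms by simp
  next
    case False
    then have e: "part_count a (insert i I) (Suc n) = part_count a (insert i I) (Suc n - a i) + part_count a I (Suc n)"
      using part_count_insert_add[of I i a "Suc n - a i"] assms by simp
    show ?thesis
    proof (cases "a i \<le> n")
      case True
      then show ?thesis using Suc e by (simp add: Suc_diff_le)
    next
      case F: False
      then have "a i = Suc n" using False by simp
      then show ?thesis using Suc e by simp
    qed
  qed
qed

text \<open>Unit cubes placed at the solutions cover the simplex of volume
  \<open>(n + 1) ^ card I / (fact (card I) * prod a I)\<close>.\<close>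

lemma sum_part_count_ge:
  assumes "finite I" "\<And>i. i \<in> I \<Longrightarrow> a i > 0"
  shows "real (n + 1) ^ card I / (fact (card I) * (\<Prod>i\<in>I. real (a i))) \<le> (\<Sum>m\<le>n. real (part_count a I m))"
  using assms
proof (induction I arbitrary: n rule: finite_induct)
  case empty
  have "(\<Sum>m\<le>n. real (part_count a {} m)) = 1"
    by (simp add: part_count_empty sum.delta if_distrib cong: if_cong)
  then show ?case by simp
next
  case (insert i I)
  define w where "w = (\<Prod>i\<in>I. real (a i))"
  define k where "k = card I"
  have w: "w > 0" unfolding w_def using insert.prems by (intro prod_pos) auto
  have ai: "a i > 0" using insert.prems by simp
  define q where "q = fact k * w"
  have q: "q > 0" using w by (simp add: q_def)
  define r where "r = (real k + 1) * (q * real (a i))"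
  have r: "r > 0" using q ai by (simp add: r_def)
  \<comment> \<open>The inner induction on \<open>n\<close> handles the solutions that use
    \<open>i\<close>, the outer one those that do not; \<open>q\<close> and \<open>r\<close> are the
    denominators for \<open>I\<close> and \<open>insert i I\<close>.\<close>
  have goal: "real (n + 1) ^ Suc k / r \<le> (\<Sum>m\<le>n. real (part_count a (insert i I) m))" for n
  proof (induction n rule: less_induct)
    case (less n)
    define x where "x = real (n + 1)"
    have x: "x > 0" by (simp add: x_def)
    have s: "(\<Sum>m\<le>n. real (part_count a (insert i I) m)) =
      (\<Sum>m\<le>n. real (part_count a I m)) + (if a i \<le> n then \<Sum>m\<le>n - a i. real (part_count a (insert i I) m) else 0)"
    proof -
      have "(\<Sum>m\<le>n. part_count a (insert i I) m) =
        (\<Sum>m\<le>n. part_count a I m) + (if a i \<le> n then \<Sum>m\<le>n - a i. part_count a (insert i I) m else 0)"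
        by (rule sum_part_count_insert) (use insert.hyps insert.prems in auto)
      from arg_cong[OF this, of real] show ?thesis by (cases "a i \<le> n") simp_all
    qed
    have IH: "x ^ k / q \<le> (\<Sum>m\<le>n. real (part_count a I m))"
      using insert.IH[of n] insert.prems by (simp add: x_def k_def q_def w_def)
    have b: "x ^ k / q = (real (Suc k) * a i * x ^ k) / r"
    proof -
      have "r = (real (Suc k) * a i) * q" by (simp add: r_def algebra_simps)
      then show ?thesis using ai by (simp only: mult.assoc) simp
    qed
    show ?case
    proof (cases "a i \<le> n")
      case True
      have "(x - a i) ^ Suc k / r \<le> (\<Sum>m\<le>n - a i. real (part_count a (insert i I) m))"
        using less[of "n - a i"] ai True by (simp add: x_def of_nat_diff algebra_simps)
      moreover have "x ^ Suc k - (x - a i) ^ Suc k \<le> real (Suc k) * a i * x ^ k"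
        by (rule power_diff_le) (use True in \<open>auto simp: x_def\<close>)
      then have "x ^ Suc k / r \<le> ((x - a i) ^ Suc k + real (Suc k) * a i * x ^ k) / r"
        using r by (intro divide_right_mono) linarith+
      then have "x ^ Suc k / r \<le> (x - a i) ^ Suc k / r + (real (Suc k) * a i * x ^ k) / r"
        by (simp only: add_divide_distrib)
      ultimately show ?thesis using s IH b True by (simp add: x_def)
    next
      case False
      \<comment> \<open>No copy of \<open>i\<close> fits, and \<open>n + 1 \<le> a i\<close> makes
        the solutions over \<open>I\<close> alone numerous enough.\<close>
      then have "x \<le> a i" by (simp add: x_def)
      then have "x * x ^ k \<le> real (a i) * x ^ k" using x by (intro mult_right_mono) auto
      also have "\<dots> \<le> real (Suc k) * a i * x ^ k" using x by (intro mult_right_mono) (auto simp: algebra_simps)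
      finally have "x ^ Suc k / r \<le> x ^ k / q" unfolding b using r by (simp add: divide_right_mono)
      then show ?thesis using s IH False by (simp add: x_def)
    qed
  qed
  have "fact (card (insert i I)) * (\<Prod>i\<in>insert i I. real (a i)) = r"
    using insert.hyps by (simp add: r_def q_def k_def w_def algebra_simps)
  then show ?case using goal[of n] insert.hyps by (simp add: k_def)
qed

subsection \<open>Quasi-polynomials\<close>

text \<open>Binomial expansion. A bound \<open>N\<close> replaces the degree because one bound has
  to serve all residue classes.\<close>

lemma coeff_shift:
  fixes p :: "real poly"
  assumes "\<forall>i\<ge>N. coeff p i = 0"
  shows "coeff (pcompose p [:t, 1:]) j = (\<Sum>i<N. coeff p i * real (i choose j) * t ^ (i - j))"
proof -
  have m: "coeff (pcompose (monom c i) [:t, 1:]) j = c * real (i choose j) * t ^ (i - j)" for c :: real and i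
  proof -
    have "degree ([:t, 1:] ^ i) = i" by (simp add: degree_power_eq)
    then have "coeff ([:t, 1:] ^ i) j = real (i choose j) * t ^ (i - j)"
      by (cases "j \<le> i") (simp_all add: coeff_linear_poly_power coeff_eq_0)
    moreover have "pcompose (monom c i) [:t, 1:] = smult c ([:t, 1:] ^ i)"
      by (intro poly_eq_poly_eq_iff[THEN iffD1] ext) (simp add: poly_pcompose poly_monom)
    ultimately show ?thesis by simp
  qed
  have "(\<Sum>i<N. monom (coeff p i) i) = p"
    by (rule poly_eqI) (use assms in \<open>auto simp: coeff_sum sum.delta not_less\<close>)
  then have "coeff (pcompose p [:t, 1:]) j = coeff (pcompose (\<Sum>i<N. monom (coeff p i) i) [:t, 1:]) j" by simp
  also have "\<dots> = (\<Sum>i<N. coeff p i * real (i choose j) * t ^ (i - j))"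
    by (simp add: pcompose_sum coeff_sum m)
  finally show ?thesis .
qed

lemma coeff_shift_zero:
  fixes p :: "real poly"
  assumes "\<forall>i\<ge>N. coeff p i = 0" "j \<ge> N"
  shows "coeff (pcompose p [:t, 1:]) j = 0"
  by (auto simp: coeff_shift[OF assms(1)] assms(2) intro!: sum.neutral) (use assms(2) in \<open>auto simp: binomial_eq_0\<close>)

text \<open>Translation alters coefficient \<open>j\<close> only through higher coefficients; this
  triangular form drives the downward inductions.\<close>

lemma coeff_shift_split:
  fixes p :: "real poly"
  assumes "\<forall>i\<ge>N. coeff p i = 0"
  shows "coeff (pcompose p [:t, 1:]) j = coeff p j + (\<Sum>i\<in>{j<..<N}. coeff p i * real (i choose j) * t ^ (i - j))"
proof (cases "j < N")
  case True
  have "coeff (pcompose p [:t, 1:]) j = (\<Sum>i\<in>insert j {j<..<N}. coeff p i * real (i choose j) * t ^ (i - j))"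
    unfolding coeff_shift[OF assms] using True
    by (intro sum.mono_neutral_right) (auto simp: binomial_eq_0)
  then show ?thesis by simp
next
  case False
  then show ?thesis using assms coeff_shift_zero[OF assms, of j] by simp
qed

lemma exists_poly_antidifference:
  fixes R :: "real poly"
  assumes "t \<noteq> 0" "\<forall>j\<ge>d. coeff R j = 0"
  shows "\<exists>S. (\<forall>j\<ge>Suc d. coeff S j = 0) \<and> (\<forall>x. poly S (x + t) - poly S x = poly R x)"
  using assms(2)
proof (induction d arbitrary: R)
  case 0
  then have "R = 0" by (intro poly_eqI) simp
  then show ?case by (intro exI[of _ 0]) simp
next
  case (Suc d)
  \<comment> \<open>The difference of c x^(d+1) with step t has leading term c (d+1) t x^d, so this
    monomial cancels the top term of \<open>R\<close>.\<close>
  define S0 where "S0 = monom (coeff R d / (real (Suc d) * t)) (Suc d)"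
  define R' where "R' = R - (pcompose S0 [:t, 1:] - S0)"
  have S0: "\<forall>j\<ge>Suc (Suc d). coeff S0 j = 0" by (simp add: S0_def)
  have "coeff R' j = 0" if "j \<ge> d" for j
  proof -
    consider "j = d" | "j = Suc d" | "j \<ge> Suc (Suc d)" using \<open>j \<ge> d\<close> by linarith
    then show ?thesis
    proof cases
      case 1
      have "{d<..<Suc (Suc d)} = {Suc d}" by auto
      then show ?thesis using 1 assms(1) coeff_shift_split[OF S0, of t d]
        by (simp add: R'_def S0_def)
    next
      case 2
      have "{Suc d<..<Suc (Suc d)} = {}" by auto
      then show ?thesis using 2 Suc.prems coeff_shift_split[OF S0, of t "Suc d"] by (simp add: R'_def)
    next
      case 3
      then show ?thesis using S0 Suc.prems coeff_shift_zero[OF S0 3] by (simp add: R'_def)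
    qed
  qed
  then obtain S where S: "\<forall>j\<ge>Suc d. coeff S j = 0" "\<forall>x. poly S (x + t) - poly S x = poly R' x"
    using Suc.IH by blast
  have "poly (S + S0) (x + t) - poly (S + S0) x = poly R x" for x
    using S(2)[rule_format, of x] by (simp add: R'_def poly_pcompose add.commute)
  moreover have "\<forall>j\<ge>Suc (Suc d). coeff (S + S0) j = 0" using S(1) S0 by simp
  ultimately show ?case by blast
qed

text \<open>\<open>P n\<close> is the polynomial of the residue class of \<open>n\<close> modulo
  \<open>L\<close>. The value at 0 is left free: without parts the count is 1 at 0 and 0 elsewhere,
  and the zero polynomial represents it.\<close>

definition quasi_poly :: "nat \<Rightarrow> (nat \<Rightarrow> real) \<Rightarrow> (nat \<Rightarrow> real poly) \<Rightarrow> bool" where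
  "quasi_poly L f P \<longleftrightarrow> (\<forall>n. P (n + L) = P n) \<and> (\<forall>n>0. f n = poly (P n) (real n))"

lemma periodic_mult:
  assumes "\<And>n::nat. f (n + L) = f n"
  shows "f (n + m * L) = f n"
proof (induction m)
  case (Suc m)
  have "n + Suc m * L = (n + m * L) + L" by simp
  then show ?case using Suc assms by metis
qed simp

lemma periodic_mod:
  assumes "\<And>n::nat. f (n + L) = f n"
  shows "f (n mod L) = f n"
  using periodic_mult[of f L "n mod L" "n div L", OF assms] by (simp add: add.commute)

lemma poly_eq_if_agree_on_progression:
  fixes p q :: "real poly"
  assumes "L > 0" "\<And>m. m > 0 \<Longrightarrow> poly p (real (n + m * L)) = poly q (real (n + m * L))"
  shows "p = q"
proof (rule ccontr)
  assume "p \<noteq> q"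
  then have "finite {x. poly (p - q) x = 0}" by (intro poly_roots_finite) simp
  moreover have "(\<lambda>m. real (n + m * L)) ` {0<..} \<subseteq> {x. poly (p - q) x = 0}"
    using assms(2) by auto
  ultimately have "finite ((\<lambda>m. real (n + m * L)) ` {0<..})" by (rule finite_subset[rotated])
  moreover have "inj_on (\<lambda>m. real (n + m * L)) {0<..}" using assms(1) by (auto simp: inj_on_def)
  ultimately have "finite {0::nat<..}" using finite_imageD by blast
  then show False by (simp add: infinite_Ioi)
qed

text \<open>Each residue class contains infinitely many arguments, so the recursion passes from
  values to polynomials and hence to coefficients.\<close>

lemma quasi_poly_difference:
  assumes f: "quasi_poly L f P" and g: "quasi_poly L g Q" and "L > 0"
    and gf: "\<And>n. g (n + t) = g n + f (n + t)"
  shows "pcompose (Q (n + t)) [:real t, 1:] - Q n = pcompose (P (n + t)) [:real t, 1:]"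
proof (rule poly_eq_if_agree_on_progression[OF \<open>L > 0\<close>])
  fix m :: nat assume m: "m > 0"
  have per: "Q (n' + m * L) = Q n'" "P (n' + m * L) = P n'" for n'
    using f g periodic_mult[of Q L] periodic_mult[of P L] by (auto simp: quasi_poly_def)
  have v: "n + m * L > 0" using m \<open>L > 0\<close> by simp
  have e: "n + m * L + t = (n + t) + m * L" by simp
  have "g (n + m * L + t) = poly (Q (n + m * L + t)) (real (n + m * L + t))"
    using g v by (simp only: quasi_poly_def)
  then have a: "g (n + m * L + t) = poly (Q (n + t)) (real (n + m * L) + real t)"
    unfolding e per by (simp add: algebra_simps)
  have "f (n + m * L + t) = poly (P (n + m * L + t)) (real (n + m * L + t))"
    using f v by (simp only: quasi_poly_def)
  then have b: "f (n + m * L + t) = poly (P (n + t)) (real (n + m * L) + real t)"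
    unfolding e per by (simp add: algebra_simps)
  have c: "g (n + m * L) = poly (Q n) (real (n + m * L))"
    using g v per(1)[of n] by (simp add: quasi_poly_def)
  show "poly (pcompose (Q (n + t)) [:real t, 1:] - Q n) (real (n + m * L)) =
      poly (pcompose (P (n + t)) [:real t, 1:]) (real (n + m * L))"
    using gf[of "n + m * L"] a b c by (simp add: poly_pcompose add.commute)
qed

text \<open>As \<open>t\<close> divides \<open>L\<close>, several steps of length \<open>t\<close>
  lead back to the same residue class. There \<open>g\<close> has polynomial increments, and a
  polynomial antidifference with step \<open>L\<close> recovers it.\<close>

lemma quasi_poly_antidifference:
  assumes f: "quasi_poly L f P" and d: "\<And>n j. j \<ge> d \<Longrightarrow> coeff (P n) j = 0"
    and L: "L > 0" "t dvd L" and gf: "\<And>n. g (n + t) = g n + f (n + t)"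
  shows "\<exists>Q. quasi_poly L g Q \<and> (\<forall>n. \<forall>j\<ge>Suc d. coeff (Q n) j = 0)"
proof -
  obtain M where M: "L = t * M" using L(2) by (elim dvdE)
  have t: "t > 0" using M L(1) by simp
  have g_mult: "g (n + t * m) = g n + (\<Sum>s<m. f (n + t * Suc s))" for n m
  proof (induction m)
    case (Suc m)
    then show ?case using gf[of "n + t * m"] by (simp add: algebra_simps)
  qed simp
  define R where "R n = (\<Sum>s<M. pcompose (P (n + t * Suc s)) [:real (t * Suc s), 1:])" for n
  have R_deg: "\<forall>j\<ge>d. coeff (R n) j = 0" for n
    unfolding R_def coeff_sum using coeff_shift_zero d by (metis (no_types, lifting) sum.neutral)
  have "\<forall>n. \<exists>S. (\<forall>j\<ge>Suc d. coeff S j = 0) \<and> (\<forall>x. poly S (x + real L) - poly S x = poly (R n) x)"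
    using exists_poly_antidifference[OF _ R_deg, of "real L"] L(1) by simp
  then obtain S where S: "\<And>n j. j \<ge> Suc d \<Longrightarrow> coeff (S n) j = 0"
      "\<And>n x. poly (S n) (x + real L) - poly (S n) x = poly (R n) x" by metis
  \<comment> \<open>The antidifference is determined up to a constant on each class; the value of
    \<open>g\<close> at the least residue fixes it.\<close>
  define Q where "Q n = S (n mod L) + [:g (n mod L) - poly (S (n mod L)) (real (n mod L)):]" for n
  have step: "g (r + m * L + L) = g (r + m * L) + poly (R r) (real (r + m * L))" for r m
  proof -
    have per: "P (n' + m * L) = P n'" for n'
      using f periodic_mult[of P L] by (auto simp: quasi_poly_def)
    have "f (r + m * L + t * Suc s) = poly (pcompose (P (r + t * Suc s)) [:real (t * Suc s), 1:]) (real (r + m * L))" for s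
    proof -
      have "r + m * L + t * Suc s > 0" using t by simp
      then have "f (r + m * L + t * Suc s) = poly (P (r + m * L + t * Suc s)) (real (r + m * L + t * Suc s))"
        using f by (simp only: quasi_poly_def)
      also have "P (r + m * L + t * Suc s) = P (r + t * Suc s)" using per[of "r + t * Suc s"]
        by (simp only: add.commute add.left_commute)
      finally show ?thesis by (simp only: poly_pcompose) (simp add: add.commute add.left_commute)
    qed
    then show ?thesis using g_mult[of "r + m * L" M] by (simp only: R_def poly_sum M[symmetric])
  qed
  have val: "g (r + m * L) = poly (S r) (real (r + m * L)) + (g r - poly (S r) (real r))" for r m
  proof (induction m)
    case (Suc m)
    have "g (r + Suc m * L) = g (r + m * L) + poly (R r) (real (r + m * L))"
      using step[of r m] by (simp add: algebra_simps)
    then show ?case using Suc S(2)[of r "real (r + m * L)"] by (simp add: algebra_simps)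
  qed simp
  have "quasi_poly L g Q"
    unfolding quasi_poly_def
  proof (intro conjI allI impI)
    fix n :: nat
    show "Q (n + L) = Q n" by (simp add: Q_def)
    show "g n = poly (Q n) (real n)"
      using val[of "n mod L" "n div L"] by (simp add: Q_def)
  qed
  moreover have "\<forall>n. \<forall>j\<ge>Suc d. coeff (Q n) j = 0"
    using S(1) by (auto simp: Q_def coeff_pCons split: nat.split)
  ultimately show ?thesis by blast
qed

lemma exists_quasi_poly_part_count:
  assumes "finite I" "\<And>i. i \<in> I \<Longrightarrow> a i > 0" "\<And>i. i \<in> I \<Longrightarrow> a i dvd L" "L > 0"
  shows "\<exists>P. quasi_poly L (\<lambda>n. real (part_count a I n)) P \<and> (\<forall>n. \<forall>j\<ge>card I. coeff (P n) j = 0)"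
  using assms(1-3)
proof (induction I rule: finite_induct)
  case empty
  then show ?case by (intro exI[of _ "\<lambda>_. 0"]) (simp add: quasi_poly_def part_count_empty)
next
  case (insert i I)
  obtain P where P: "quasi_poly L (\<lambda>n. real (part_count a I n)) P" "\<forall>n. \<forall>j\<ge>card I. coeff (P n) j = 0"
    using insert.IH insert.prems by auto
  have "\<exists>Q. quasi_poly L (\<lambda>n. real (part_count a (insert i I) n)) Q \<and> (\<forall>n. \<forall>j\<ge>Suc (card I). coeff (Q n) j = 0)"
  proof (rule quasi_poly_antidifference[OF P(1)])
    show "a i dvd L" using insert.prems by simp
    show "real (part_count a (insert i I) (n + a i)) =
        real (part_count a (insert i I) n) + real (part_count a I (n + a i))" for n
      using part_count_insert_add[of I i a n] insert.hyps insert.prems by simp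
  qed (use P(2) \<open>L > 0\<close> in auto)
  then show ?case using insert.hyps by simp
qed

section \<open>Periods and means of the coefficients\<close>

lemma sum_periodic_shift:
  fixes f :: "nat \<Rightarrow> real"
  assumes "\<And>n. f (n + L) = f n"
  shows "(\<Sum>n<L. f (n + t)) = (\<Sum>n<L. f n)"
proof (induction t)
  case (Suc t)
  have "(\<Sum>n<Suc L. f (n + t)) = f t + (\<Sum>n<L. f (n + Suc t))"
    by (subst sum.lessThan_Suc_shift) simp
  moreover have "f (L + t) = f t" using assms[of t] by (simp add: add.commute)
  ultimately show ?case using Suc by simp
qed simp

text \<open>A shift leaves the sum over a full period unchanged, whereas the increments add
  \<open>L\<close> times \<open>c\<close>.\<close>

lemma periodic_increment_eq_0:
  fixes f :: "nat \<Rightarrow> real"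
  assumes "\<And>n. f (n + L) = f n" "L > 0" "\<And>n. f (n + t) = f n + c"
  shows "c = 0"
  using sum_periodic_shift[of f L t, OF assms(1)] assms(2) by (simp add: assms(3) sum.distrib)

lemma periodic_Gcd:
  fixes a :: "'i \<Rightarrow> nat" and f :: "nat \<Rightarrow> 'b"
  assumes "finite I" "\<And>i. i \<in> I \<Longrightarrow> a i > 0" "\<And>i n. i \<in> I \<Longrightarrow> f (n + a i) = f n"
  shows "f (n + Gcd (a ` I)) = f n"
  using assms
proof (induction I arbitrary: n rule: finite_induct)
  case (insert i I)
  have IH: "f (n + Gcd (a ` I)) = f n" for n using insert by auto
  have "a i \<noteq> 0" using insert.prems(1) by (metis insertI1 less_irrefl)
  \<comment> \<open>Subtraction-free Bezout: a shift by the new gcd followed by \<open>y\<close>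
    shifts by the old one amounts to \<open>x\<close> shifts by \<open>a i\<close>.\<close>
  then obtain x y where xy: "a i * x = Gcd (a ` I) * y + gcd (a i) (Gcd (a ` I))"
    using bezout_nat by blast
  have "f (n + gcd (a i) (Gcd (a ` I))) = f (n + gcd (a i) (Gcd (a ` I)) + y * Gcd (a ` I))"
    using periodic_mult[of f "Gcd (a ` I)", OF IH] by simp
  also have "n + gcd (a i) (Gcd (a ` I)) + y * Gcd (a ` I) = n + x * a i"
    using xy by (simp add: algebra_simps)
  also have "f (n + x * a i) = f n"
    using periodic_mult[of f "a i"] insert.prems(2) by simp
  finally show ?case by simp
qed simp

lemma part_count_singleton:
  assumes "a i > 0"
  shows "part_count a {i} n = (if a i dvd n then 1 else 0)"
proof (induction n rule: less_induct)
  case (less n)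
  show ?case
  proof (cases "n < a i")
    case True
    then show ?thesis using part_count_insert_less[of "{}" i n a]
      by (auto simp: part_count_empty dest: dvd_imp_le)
  next
    case False
    then have "part_count a {i} n = part_count a {i} (n - a i)"
      using part_count_insert_add[of "{}" i a "n - a i"] assms by (simp add: part_count_empty)
    moreover have "a i dvd n \<longleftrightarrow> a i dvd n - a i"
      using False by (simp add: dvd_minus_self)
    ultimately show ?thesis using less[of "n - a i"] False assms by simp
  qed
qed

lemma quasi_poly_part_count_difference:
  assumes "finite I" "i \<notin> I" "\<And>j. j \<in> insert i I \<Longrightarrow> a j > 0" "L > 0"
    and "quasi_poly L (\<lambda>n. real (part_count a (insert i I) n)) Q"
    and "quasi_poly L (\<lambda>n. real (part_count a I n)) P"
  shows "pcompose (Q (n + a i)) [:real (a i), 1:] - Q n = pcompose (P (n + a i)) [:real (a i), 1:]"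
  by (rule quasi_poly_difference[OF assms(6,5,4)])
    (use part_count_insert_add[of I i a] assms(1-3) in simp)

text \<open>The mean of the leading coefficient is accessible even where that coefficient
  oscillates. Summing the relation for the next lower coefficient over a period cancels that
  coefficient itself and leaves a factor \<open>(k + 1) a i\<close> between the leading sums for
  \<open>insert i I\<close> and \<open>I\<close>.\<close>

lemma sum_leading_coeff_part_count:
  assumes "finite I" "I \<noteq> {}" "\<And>i. i \<in> I \<Longrightarrow> a i > 0" "\<And>i. i \<in> I \<Longrightarrow> a i dvd L" "L > 0"
    and "quasi_poly L (\<lambda>n. real (part_count a I n)) P" "\<And>n j. j \<ge> card I \<Longrightarrow> coeff (P n) j = 0"
  shows "(\<Sum>n<L. coeff (P n) (card I - 1)) = real L / (fact (card I - 1) * (\<Prod>i\<in>I. real (a i)))"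
  using assms
proof (induction I arbitrary: P rule: finite_ne_induct)
  case (singleton i)
  have const: "P n = [:coeff (P n) 0:]" for n
    by (rule poly_eqI) (use singleton.prems(5) in \<open>auto simp: coeff_pCons split: nat.split\<close>)
  have per: "P (n + L) = P n" for n using singleton.prems by (simp add: quasi_poly_def)
  have v: "coeff (P n) 0 = (if a i dvd n then 1 else 0)" for n
  proof -
    \<comment> \<open>Evaluating at \<open>n + L\<close> keeps the argument positive also for
      \<open>n = 0\<close>.\<close>
    have "real (part_count a {i} (n + L)) = poly (P (n + L)) (real (n + L))"
      using singleton.prems(3,4) unfolding quasi_poly_def by simp
    also have "P (n + L) = P n" by (rule per)
    also have "poly (P n) (real (n + L)) = coeff (P n) 0"
      by (subst const) simp
    finally have "coeff (P n) 0 = real (part_count a {i} (n + L))" ..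
    moreover have "a i dvd n + L \<longleftrightarrow> a i dvd n"
      using singleton.prems(2)[of i] by (simp add: dvd_add_left_iff)
    ultimately show ?thesis using singleton.prems(1) by (simp add: part_count_singleton)
  qed
  obtain M where M: "L = a i * M" using singleton.prems(2)[of i] by (auto elim: dvdE)
  have ai: "a i > 0" using singleton.prems(1) by simp
  have "(\<Sum>n<L. coeff (P n) 0) = real (card {n\<in>{..<L}. a i dvd n})"
    by (simp add: v sum.If_cases Int_def)
  also have "{n\<in>{..<L}. a i dvd n} = (\<lambda>m. a i * m) ` {..<M}"
    using ai by (auto simp: M elim!: dvdE)
  also have "card \<dots> = M" using ai by (subst card_image) (auto simp: inj_on_def)
  finally show ?case using ai by (simp add: M)
next
  case (insert i I)
  define k where "k = card I - 1"
  have ck: "card I = Suc k" using insert.hyps by (simp add: k_def card_gt_0_iff)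
  have "\<exists>P'. quasi_poly L (\<lambda>n. real (part_count a I n)) P' \<and> (\<forall>n. \<forall>j\<ge>card I. coeff (P' n) j = 0)"
    by (rule exists_quasi_poly_part_count) (use insert.hyps insert.prems in auto)
  then obtain P' where P': "quasi_poly L (\<lambda>n. real (part_count a I n)) P'"
      "\<And>n j. j \<ge> card I \<Longrightarrow> coeff (P' n) j = 0" by blast
  have IH: "(\<Sum>n<L. coeff (P' n) k) = real L / (fact k * (\<Prod>i\<in>I. real (a i)))"
    unfolding k_def by (rule insert.IH) (use insert.prems P' in auto)
  have perP: "P (n + L) = P n" for n using insert.prems by (simp add: quasi_poly_def)
  have perP': "P' (n + L) = P' n" for n using P' by (simp add: quasi_poly_def)
  have v: "\<forall>j\<ge>Suc (Suc k). coeff (P n) j = 0" for n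
    using insert.prems(5) insert.hyps ck by simp
  have v': "\<forall>j\<ge>Suc k. coeff (P' n) j = 0" for n using P'(2) ck by simp
  have s: "{k<..<Suc (Suc k)} = {Suc k}" "{k<..<Suc k} = {}" by auto
  have "pcompose (P (n + a i)) [:real (a i), 1:] - P n = pcompose (P' (n + a i)) [:real (a i), 1:]" for n
    by (rule quasi_poly_part_count_difference[of I i a L])
      (use insert.hyps insert.prems P' in auto)
  from arg_cong[OF this, of "\<lambda>p. coeff p k"]
  have "coeff (P (n + a i)) k + (real k + 1) * real (a i) * coeff (P (n + a i)) (Suc k) - coeff (P n) k
      = coeff (P' (n + a i)) k" for n
    using coeff_shift_split[OF v[of "n + a i"], of "real (a i)" k]
      coeff_shift_split[OF v'[of "n + a i"], of "real (a i)" k] s by (simp add: algebra_simps)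
  then have "(\<Sum>n<L. coeff (P (n + a i)) k + (real k + 1) * real (a i) * coeff (P (n + a i)) (Suc k) - coeff (P n) k)
      = (\<Sum>n<L. coeff (P' (n + a i)) k)" by simp
  then have "(real k + 1) * real (a i) * (\<Sum>n<L. coeff (P n) (Suc k)) = (\<Sum>n<L. coeff (P' n) k)"
    using sum_periodic_shift[of "\<lambda>n. coeff (P n) k" L "a i"] sum_periodic_shift[of "\<lambda>n. coeff (P n) (Suc k)" L "a i"]
      sum_periodic_shift[of "\<lambda>n. coeff (P' n) k" L "a i"] perP perP'
    by (simp add: sum.distrib sum_subtractf flip: sum_distrib_left)
  moreover have "real (a i) > 0" using insert.prems by simp
  ultimately have "(\<Sum>n<L. coeff (P n) (Suc k)) = (\<Sum>n<L. coeff (P' n) k) / ((real k + 1) * real (a i))"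
    by (metis nonzero_mult_div_cancel_left mult_eq_0_iff less_irrefl of_nat_0_less_iff of_nat_Suc add.commute zero_less_Suc)
  then show ?case using insert.hyps IH by (simp add: ck algebra_simps)
qed

text \<open>Two inductions are nested: over subsets of \<open>I\<close>, which inherit the bound
  \<open>m\<close>, and downward in \<open>j\<close>. Once the higher coefficients for
  \<open>I\<close> and those from \<open>j\<close> on for \<open>I - {i}\<close> are constant, a
  shift by \<open>a i\<close> changes coefficient \<open>j\<close> by an amount independent of
  \<open>n\<close>, which periodicity forces to be 0.\<close>

lemma coeff_part_count_constant:
  assumes "finite I" "\<And>i. i \<in> I \<Longrightarrow> a i > 0" "\<And>i. i \<in> I \<Longrightarrow> a i dvd L" "L > 0"
    and "quasi_poly L (\<lambda>n. real (part_count a I n)) P" "\<And>n j. j \<ge> card I \<Longrightarrow> coeff (P n) j = 0"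
    and "\<And>d. d \<ge> 2 \<Longrightarrow> card {i\<in>I. d dvd a i} \<le> m" "j \<ge> m"
  shows "coeff (P n) j = coeff (P 0) j"
  using assms(1-7) \<open>j \<ge> m\<close>
proof (induction I arbitrary: P n j rule: finite_psubset_induct)
  case (psubset I)
  have per: "P (n + L) = P n" for n using psubset.prems by (simp add: quasi_poly_def)
  have v: "\<forall>j\<ge>card I. coeff (P n) j = 0" for n using psubset.prems(5) by blast
  show ?case using \<open>j \<ge> m\<close>
  proof (induction "card I - j" arbitrary: j n rule: less_induct)
    case less
    show ?case
    proof (cases "j < card I")
      case False
      then show ?thesis using v by simp
    next
      case True
      have IHj: "coeff (P n) j' = coeff (P 0) j'" if "j' > j" for j' n
      proof (cases "j' < card I")
        case True
        then show ?thesis using less.hyps[of j' n] less.prems that by simp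
      next
        case False
        then show ?thesis using v by simp
      qed
      have inv: "coeff (P (n + a i)) j = coeff (P n) j" if i: "i \<in> I" for i n
      proof -
        define I' where "I' = I - {i}"
        have I': "I = insert i I'" "i \<notin> I'" "I' \<subset> I" "finite I'" using i psubset.hyps by (auto simp: I'_def)
        have "\<exists>P'. quasi_poly L (\<lambda>n. real (part_count a I' n)) P' \<and> (\<forall>n. \<forall>j\<ge>card I'. coeff (P' n) j = 0)"
          by (rule exists_quasi_poly_part_count) (use I' psubset.prems in auto)
        then obtain P' where P': "quasi_poly L (\<lambda>n. real (part_count a I' n)) P'"
            "\<And>n j. j \<ge> card I' \<Longrightarrow> coeff (P' n) j = 0" by blast
        have "card {i\<in>I'. d dvd a i} \<le> m" if "d \<ge> 2" for d
        proof -
          have "card {i\<in>I'. d dvd a i} \<le> card {i\<in>I. d dvd a i}"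
            using I' psubset.hyps by (intro card_mono) auto
          then show ?thesis using psubset.prems(6)[OF that] by simp
        qed
        then have IH: "coeff (P' n) j' = coeff (P' 0) j'" if "j' \<ge> m" for n j'
          using psubset.IH[of I' P' j' n] I' P' psubset.prems that by auto
        have v': "\<forall>j\<ge>card I'. coeff (P' n) j = 0" for n using P' by simp
        have rel: "pcompose (P (n + a i)) [:real (a i), 1:] - P n = pcompose (P' (n + a i)) [:real (a i), 1:]" for n
          by (rule quasi_poly_part_count_difference[of I' i a L]) (use I' psubset.prems P' in auto)
        define c where "c = coeff (P' 0) j + (\<Sum>l\<in>{j<..<card I'}. coeff (P' 0) l * real (l choose j) * real (a i) ^ (l - j))
            - (\<Sum>l\<in>{j<..<card I}. coeff (P 0) l * real (l choose j) * real (a i) ^ (l - j))"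
        have step: "coeff (P (n + a i)) j = coeff (P n) j + c" for n
        proof -
          have 1: "coeff (pcompose (P (n + a i)) [:real (a i), 1:]) j = coeff (P (n + a i)) j +
             (\<Sum>l\<in>{j<..<card I}. coeff (P 0) l * real (l choose j) * real (a i) ^ (l - j))"
            unfolding coeff_shift_split[OF v] by (auto intro!: sum.cong IHj)
          have 2: "coeff (pcompose (P' (n + a i)) [:real (a i), 1:]) j = coeff (P' 0) j +
             (\<Sum>l\<in>{j<..<card I'}. coeff (P' 0) l * real (l choose j) * real (a i) ^ (l - j))"
            unfolding coeff_shift_split[OF v'] using IH[of j "n + a i"] less.prems by (auto intro!: sum.cong IH)
          from arg_cong[OF rel[of n], of "\<lambda>p. coeff p j"] show ?thesis
            using 1 2 by (simp add: c_def)
        qed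
        have "c = 0"
          by (rule periodic_increment_eq_0[of "\<lambda>n. coeff (P n) j" L "a i"])
            (use per step psubset.prems in auto)
        then show ?thesis using step by simp
      qed
      have gper: "coeff (P (n + Gcd (a ` I))) j = coeff (P n) j" for n
        by (rule periodic_Gcd) (use psubset.hyps psubset.prems inv in auto)
      \<comment> \<open>A gcd of at least 2 would divide all \<open>card I\<close> parts, but at
        most \<open>m \<le> j < card I\<close> are allowed.\<close>
      have "Gcd (a ` I) = 1"
      proof (rule ccontr)
        assume "Gcd (a ` I) \<noteq> 1"
        moreover obtain i where "i \<in> I" using True by fastforce
        then have "Gcd (a ` I) \<noteq> 0" using psubset.prems(1)[of i] by (auto simp: Gcd_0_iff)
        ultimately have "Gcd (a ` I) \<ge> 2" by linarith
        then have "card {i\<in>I. Gcd (a ` I) dvd a i} \<le> m" by (rule psubset.prems(6))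
        moreover have "{i\<in>I. Gcd (a ` I) dvd a i} = I" by auto
        ultimately show False using True less.prems by simp
      qed
      then have "coeff (P (0 + n * 1)) j = coeff (P 0) j"
        using periodic_mult[of "\<lambda>n. coeff (P n) j" 1 0 n] gper by simp
      then show ?thesis by simp
    qed
  qed
qed

subsection \<open>Asymptotic expansions and log-concavity\<close>

text \<open>The perturbations have order 1/w. After multiplication by \<open>w\<close> only the
  terms linear in them survive; the quadratic ones and, by hypothesis, the main parts
  vanish.\<close>

lemma second_difference_product_tendsto:
  fixes w A B C x' y' z' :: "'a \<Rightarrow> real"
  assumes w: "filterlim w at_top F"
    and lim: "(A \<longlongrightarrow> c) F" "(B \<longlongrightarrow> c) F" "(C \<longlongrightarrow> c) F"
    and ABC: "((\<lambda>m. w m * ((A m)^2 - B m * C m)) \<longlongrightarrow> 0) F"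
    and x: "((\<lambda>m. w m * x' m) \<longlongrightarrow> x) F" and y: "((\<lambda>m. w m * y' m) \<longlongrightarrow> y) F"
    and z: "((\<lambda>m. w m * z' m) \<longlongrightarrow> z) F"
  shows "((\<lambda>m. w m * ((A m + x' m)^2 - (B m + y' m) * (C m + z' m))) \<longlongrightarrow> c * (2 * x - y - z)) F"
proof -
  have small: "(v \<longlongrightarrow> 0) F" if v: "((\<lambda>m. w m * v m) \<longlongrightarrow> l) F" for v :: "'a \<Rightarrow> real" and l
  proof -
    have "((\<lambda>m. (w m * v m) * inverse (w m)) \<longlongrightarrow> 0) F"
      using tendsto_mult[OF v tendsto_inverse_0_at_top[OF w]] by simp
    moreover have "\<forall>\<^sub>F m in F. (w m * v m) * inverse (w m) = v m"
      using filterlim_at_top_dense[THEN iffD1, OF w, rule_format, of 0] by eventually_elim simp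
    ultimately show ?thesis by (rule Lim_transform_eventually)
  qed
  have "((\<lambda>m. w m * ((A m)^2 - B m * C m) + 2 * A m * (w m * x' m) + x' m * (w m * x' m)
      - B m * (w m * z' m) - C m * (w m * y' m) - y' m * (w m * z' m))
      \<longlongrightarrow> 0 + 2 * c * x + 0 * x - c * z - c * y - 0 * z) F"
    by (intro tendsto_intros assms small[OF x] small[OF y])
  then show ?thesis by (simp add: algebra_simps power2_eq_square)
qed

lemma periodic_bounded:
  fixes f :: "nat \<Rightarrow> real"
  assumes "\<And>n. f (n + L) = f n" "L > 0"
  shows "\<exists>B. \<forall>n. \<bar>f n\<bar> \<le> B"
proof (intro exI allI)
  fix n
  have "\<bar>f n\<bar> = \<bar>f (n mod L)\<bar>" using periodic_mod[of f L, OF assms(1)] by simp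
  also have "\<dots> \<le> (\<Sum>s<L. \<bar>f s\<bar>)" using assms(2) by (intro member_le_sum) auto
  finally show "\<bar>f n\<bar> \<le> (\<Sum>s<L. \<bar>f s\<bar>)" .
qed

locale quasi_poly_expansion =
  fixes f :: "nat \<Rightarrow> real" and L k :: nat and P :: "nat \<Rightarrow> real poly"
  assumes quasi: "quasi_poly L f P" and vanish: "\<And>n j. j \<ge> k \<Longrightarrow> coeff (P n) j = 0"
    and L_pos: "L > 0" and k_pos: "k > 0"
begin

text \<open>Numbered from the top: \<open>e i\<close> belongs to n^(k-1-i), hence to n^-i in the
  expansion of \<open>u\<close>. The value 0 beyond \<open>k\<close> lets the same formulas cover
  \<open>k < 3\<close>.\<close>

definition e :: "nat \<Rightarrow> nat \<Rightarrow> real" where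
  "e i n = (if i < k then coeff (P n) (k - 1 - i) else 0)"

definition u :: "nat \<Rightarrow> real" where
  "u n = f n / real n ^ (k - 1)"

lemma e_periodic: "e i (n + L) = e i n"
  using quasi by (simp add: e_def quasi_poly_def)

lemma u_eq_sum:
  assumes "n > 0"
  shows "u n = (\<Sum>i<k. e i n / real n ^ i)"
proof -
  have "f n = poly (P n) (real n)" using quasi assms by (simp add: quasi_poly_def)
  also have "(\<Sum>j<k. monom (coeff (P n) j) j) = P n"
    by (rule poly_eqI) (use vanish in \<open>auto simp: coeff_sum not_less\<close>)
  then have "poly (P n) (real n) = poly (\<Sum>j<k. monom (coeff (P n) j) j) (real n)" by simp
  also have "\<dots> = (\<Sum>j<k. coeff (P n) j * real n ^ j)" by (simp add: poly_sum poly_monom)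
  also have "\<dots> = (\<Sum>i<k. coeff (P n) (k - Suc i) * real n ^ (k - Suc i))"
    by (rule sum.nat_diff_reindex[symmetric])
  finally have "u n = (\<Sum>i<k. coeff (P n) (k - Suc i) * real n ^ (k - Suc i) / real n ^ (k - 1))"
    by (simp add: u_def sum_divide_distrib)
  also have "\<dots> = (\<Sum>i<k. e i n / real n ^ i)"
  proof (rule sum.cong)
    fix i assume i: "i \<in> {..<k}"
    then have "k - 1 = (k - Suc i) + i" by simp
    then have "real n ^ (k - 1) = real n ^ (k - Suc i) * real n ^ i" by (metis power_add)
    then show "coeff (P n) (k - Suc i) * real n ^ (k - Suc i) / real n ^ (k - 1) = e i n / real n ^ i"
      using assms i by (simp add: e_def)
  qed simp
  finally show ?thesis .
qed

lemma expansion_bound: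
  "\<exists>B. \<forall>n>0. \<bar>u n - (\<Sum>i<r. e i n / real n ^ i)\<bar> \<le> B / real n ^ r"
proof -
  have "\<forall>i. \<exists>B. \<forall>n. \<bar>e i n\<bar> \<le> B" using periodic_bounded[of "e i" L for i, OF e_periodic L_pos] by blast
  then obtain B where B: "\<And>i n. \<bar>e i n\<bar> \<le> B i" by metis
  show ?thesis
  proof (intro exI allI impI)
    fix n :: nat assume n: "n > 0"
    \<comment> \<open>Padding with zero coefficients makes the split at \<open>r\<close> possible
      also for \<open>r > k\<close>.\<close>
    have "u n = (\<Sum>i<k + r. e i n / real n ^ i)"
      unfolding u_eq_sum[OF n] by (rule sum.mono_neutral_left) (auto simp: e_def)
    also have "{..<k + r} = {..<r} \<union> {r..<k + r}" by auto
    finally have "u n = (\<Sum>i<r. e i n / real n ^ i) + (\<Sum>i\<in>{r..<k + r}. e i n / real n ^ i)"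
      by (subst (asm) sum.union_disjoint) auto
    then have "\<bar>u n - (\<Sum>i<r. e i n / real n ^ i)\<bar> \<le> (\<Sum>i\<in>{r..<k + r}. \<bar>e i n / real n ^ i\<bar>)"
      by (simp only: add_diff_cancel_left' sum_abs)
    also have "\<dots> \<le> (\<Sum>i\<in>{r..<k + r}. B i / real n ^ r)"
    proof (rule sum_mono)
      fix i assume "i \<in> {r..<k + r}"
      then have "real n ^ r \<le> real n ^ i" using n by (intro power_increasing) auto
      then show "\<bar>e i n / real n ^ i\<bar> \<le> B i / real n ^ r"
        using B[of i n] n by (simp add: abs_divide) (intro frac_le, auto)
    qed
    also have "\<dots> = (\<Sum>i\<in>{r..<k + r}. B i) / real n ^ r" by (simp add: sum_divide_distrib)
    finally show "\<bar>u n - (\<Sum>i<r. e i n / real n ^ i)\<bar> \<le> (\<Sum>i\<in>{r..<k + r}. B i) / real n ^ r" .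
  qed
qed

lemma expansion_tendsto:
  "(\<lambda>n. real n ^ r * (u n - (\<Sum>i<r. e i n / real n ^ i)) - e r n) \<longlonglongrightarrow> 0"
proof -
  obtain B where B: "\<And>n. n > 0 \<Longrightarrow> \<bar>u n - (\<Sum>i<Suc r. e i n / real n ^ i)\<bar> \<le> B / real n ^ Suc r"
    using expansion_bound[of "Suc r"] by blast
  have "(\<lambda>n. B / real n) \<longlonglongrightarrow> 0" by real_asymp
  then show ?thesis
  proof (rule Lim_null_comparison[rotated])
    show "\<forall>\<^sub>F n in sequentially. norm (real n ^ r * (u n - (\<Sum>i<r. e i n / real n ^ i)) - e r n) \<le> B / real n"
      using eventually_gt_at_top[of 0]
    proof eventually_elim
      case (elim n)
      have "real n ^ r * (u n - (\<Sum>i<r. e i n / real n ^ i)) - e r n = real n ^ r * (u n - (\<Sum>i<Suc r. e i n / real n ^ i))"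
        using elim by (simp add: field_simps)
      moreover have "norm (real n ^ r * D) \<le> real n ^ r * (B / real n ^ Suc r)" if "\<bar>D\<bar> \<le> B / real n ^ Suc r" for D
        using mult_left_mono[OF that, of "real n ^ r"] by (simp add: abs_mult)
      ultimately have "norm (real n ^ r * (u n - (\<Sum>i<r. e i n / real n ^ i)) - e r n)
          \<le> real n ^ r * (B / real n ^ Suc r)"
        using B[OF elim] by (simp only:)
      then show ?case using elim by simp
    qed
  qed
qed

lemma u_tendsto:
  assumes "\<And>n. e 0 n = c"
  shows "u \<longlonglongrightarrow> c"
proof -
  have "(\<lambda>n. u n - c) \<longlonglongrightarrow> 0" using expansion_tendsto[of 0] assms by simp
  then show ?thesis by (rule LIM_zero_cancel)
qed

text \<open>The constant lower-order part \<open>A\<close> contributes nothing at order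
  \<open>q\<close>, so the limit sees only \<open>e q\<close>. The sequence \<open>h\<close> is
  meant to run through one residue class, where the three neighbouring values of \<open>e q\<close>
  are fixed; \<open>x\<close> is the middle one.\<close>

lemma scaled_second_difference_tendsto:
  fixes h :: "nat \<Rightarrow> nat"
  assumes h: "filterlim h at_top sequentially" and q: "q = 1 \<or> q = 2"
    and const: "\<And>i n. i < q \<Longrightarrow> e i n = c i"
    and xyz: "\<And>m. e q (h m) = z" "\<And>m. e q (h m + 1) = x" "\<And>m. e q (h m + 2) = y"
  shows "(\<lambda>m. real (h m + 1) ^ q * ((u (h m + 1))^2 - u (h m + 2) * u (h m))) \<longlonglongrightarrow> c 0 * (2 * x - y - z)"
proof -
  define A where "A t = (\<Sum>i<q. c i / t ^ i)" for t :: real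
  have A_eq: "A t = c 0 + (if q = 2 then c 1 / t else 0)" for t
    using q by (auto simp: A_def numeral_2_eq_2)
  have t: "filterlim (\<lambda>m. real (h m)) at_top sequentially"
    by (rule filterlim_compose[OF filterlim_real_sequentially h])
  have lim: "((\<lambda>t. A t) \<longlongrightarrow> c 0) at_top" "((\<lambda>t. A (t + 1)) \<longlongrightarrow> c 0) at_top" "((\<lambda>t. A (t + 2)) \<longlongrightarrow> c 0) at_top"
    unfolding A_eq by (cases "q = 2"; simp; real_asymp)+
  have r0: "((\<lambda>t::real. (t + 1) ^ q * (1 / t ^ q)) \<longlongrightarrow> 1) at_top"
      "((\<lambda>t::real. (t + 1) ^ q * (1 / (t + 2) ^ q)) \<longlongrightarrow> 1) at_top"
    by (rule disjE[OF q]; simp only: power_one_right; real_asymp)+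
  have w: "filterlim (\<lambda>t::real. (t + 1) ^ q) at_top at_top"
    by (rule disjE[OF q]; simp only: power_one_right; real_asymp)
  \<comment> \<open>For \<open>q = 2\<close> the second difference of 1/t has order t^-3 and the
    term quadratic in \<open>c 1\<close> has order t^-4; both beat the weight. For
    \<open>q = 1\<close> the main part is constant.\<close>
  have ABC: "((\<lambda>t. (t + 1) ^ q * ((A (t + 1))^2 - A (t + 2) * A t)) \<longlongrightarrow> 0) at_top"
  proof (cases "q = 2")
    case True
    have l1: "((\<lambda>t::real. (t + 1)^2 * (2 / (t + 1) - 1 / (t + 2) - 1 / t)) \<longlongrightarrow> 0) at_top" by real_asymp
    have l2: "((\<lambda>t::real. (t + 1)^2 * (1 / (t + 1)^2 - 1 / (t + 2) * (1 / t))) \<longlongrightarrow> 0) at_top" by real_asymp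
    have "((\<lambda>t::real. c 0 * c 1 * ((t + 1)^2 * (2 / (t + 1) - 1 / (t + 2) - 1 / t)) +
        (c 1)^2 * ((t + 1)^2 * (1 / (t + 1)^2 - 1 / (t + 2) * (1 / t)))) \<longlongrightarrow> c 0 * c 1 * 0 + (c 1)^2 * 0) at_top"
      by (intro tendsto_intros l1 l2)
    moreover have "c 0 * c 1 * (w * (2 / a - 1 / b - 1 / d)) + (c 1)^2 * (w * (1 / a^2 - 1 / b * (1 / d)))
        = w * ((c 0 + c 1 / a)^2 - (c 0 + c 1 / b) * (c 0 + c 1 / d))" for w a b d :: real
      by (simp add: power2_eq_square divide_inverse algebra_simps)
    ultimately show ?thesis unfolding A_eq using True by simp
  next
    case False
    then show ?thesis unfolding A_eq by (simp add: power2_eq_square)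
  qed
  have rem: "(\<lambda>m. real (h m + s) ^ q * (u (h m + s) - A (real (h m + s)))) \<longlonglongrightarrow> l"
    if "\<And>m. e q (h m + s) = l" for s l
  proof -
    have "filterlim (\<lambda>m. h m + s) at_top sequentially"
      by (rule filterlim_at_top_mono[OF h]) simp
    from filterlim_compose[OF expansion_tendsto[of q] this]
    have "(\<lambda>m. real (h m + s) ^ q * (u (h m + s) - A (real (h m + s))) - l) \<longlonglongrightarrow> 0"
      using const that by (simp add: A_def)
    from tendsto_add[OF this tendsto_const[of l]] show ?thesis by simp
  qed
  \<comment> \<open>In \<open>rem\<close> each point has its own weight; the ratios of weights tend
    to 1, so the weight of the middle point can serve all three.\<close>
  have conv: "(\<lambda>m. (real (h m) + 1) ^ q * (u (h m + s) - A (real (h m) + real s))) \<longlonglongrightarrow> l"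
    if l: "\<And>m. e q (h m + s) = l" and s: "s \<in> {0, 1, 2}" for s l
  proof -
    have "((\<lambda>t::real. (t + 1) ^ q * (1 / (t + real s) ^ q)) \<longlongrightarrow> 1) at_top"
    proof (cases "s = 1")
      case True
      have "\<forall>\<^sub>F t::real in at_top. (t + 1) ^ q * (1 / (t + real s) ^ q) = 1"
        using eventually_gt_at_top[of 0] by eventually_elim (simp add: True)
      then show ?thesis by (simp add: tendsto_eventually)
    qed (use r0 s in auto)
    from tendsto_mult[OF filterlim_compose[OF this t] rem[OF l]]
    have "(\<lambda>m. (real (h m) + 1) ^ q * (1 / (real (h m) + real s) ^ q) *
        (real (h m + s) ^ q * (u (h m + s) - A (real (h m + s))))) \<longlonglongrightarrow> l" by simp
    moreover have "\<forall>\<^sub>F m in sequentially. (real (h m) + 1) ^ q * (1 / (real (h m) + real s) ^ q) *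
        (real (h m + s) ^ q * (u (h m + s) - A (real (h m + s)))) =
        (real (h m) + 1) ^ q * (u (h m + s) - A (real (h m) + real s))"
      using filterlim_at_top_dense[THEN iffD1, OF t, rule_format, of 0]
      by eventually_elim (simp add: add_pos_nonneg)
    ultimately show ?thesis by (rule Lim_transform_eventually)
  qed
  have "(\<lambda>m. (real (h m) + 1) ^ q * ((A (real (h m) + 1) + (u (h m + 1) - A (real (h m) + real 1)))^2
      - (A (real (h m) + 2) + (u (h m + 2) - A (real (h m) + real 2))) * (A (real (h m)) + (u (h m + 0) - A (real (h m) + real 0)))))
      \<longlonglongrightarrow> c 0 * (2 * x - y - z)"
    by (rule second_difference_product_tendsto)
      (use filterlim_compose[OF w t] filterlim_compose[OF lim(1) t] filterlim_compose[OF lim(2) t]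
        filterlim_compose[OF lim(3) t] filterlim_compose[OF ABC t] conv[of 0 z] conv[of 1 x] conv[of 2 y] xyz in simp_all)
  then show ?thesis by (simp add: add.commute)
qed

text \<open>Writing the quotient by n^\<alpha> as \<open>u n\<close> times n^(k-1-\<alpha>) isolates
  the powers, and n (n + 2) / (n + 1)^2 = 1 - 1 / (n + 1)^2.\<close>

lemma log_concave_iff:
  assumes "n > 0"
  shows "(f (n + 1) / real (n + 1) powr \<alpha>) ^ 2 > (f (n + 2) / real (n + 2) powr \<alpha>) * (f n / real n powr \<alpha>)
    \<longleftrightarrow> (u (n + 1))^2 > u (n + 2) * u n * (1 - 1 / (real n + 1)^2) powr (real k - 1 - \<alpha>)"
proof -
  define \<beta> where "\<beta> = real k - 1 - \<alpha>"
  have r: "f m / real m powr \<alpha> = u m * real m powr \<beta>" if "m > 0" for m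
  proof -
    have "real m powr \<beta> * real m powr \<alpha> = real m powr (real (k - 1))"
      using k_pos by (simp add: \<beta>_def of_nat_diff flip: powr_add)
    also have "\<dots> = real m ^ (k - 1)" using that by (simp add: powr_realpow)
    finally show ?thesis using that by (simp add: u_def field_simps)
  qed
  have base: "1 - 1 / (real n + 1)^2 = real n * real (n + 2) / (real (n + 1))^2"
  proof -
    have "real n * real (n + 2) = (real (n + 1))^2 - 1" by (simp add: algebra_simps power2_eq_square)
    then show ?thesis by (simp only:) (simp add: diff_divide_distrib add.commute)
  qed
  have pw: "(1 - 1 / (real n + 1)^2) powr \<beta> = real n powr \<beta> * real (n + 2) powr \<beta> / (real (n + 1) powr \<beta>)^2"
    unfolding base by (simp add: powr_divide powr_mult power2_eq_square)
  have pos: "(real (n + 1) powr \<beta>)^2 > 0" by simp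
  have "(u (n + 1))^2 > u (n + 2) * u n * (1 - 1 / (real n + 1)^2) powr \<beta> \<longleftrightarrow>
      (u (n + 1))^2 * (real (n + 1) powr \<beta>)^2 > u (n + 2) * u n * (real n powr \<beta> * real (n + 2) powr \<beta>)"
    unfolding pw using pos by (simp add: field_simps del: of_nat_add)
  then show ?thesis using r[of n] r[of "n + 1"] r[of "n + 2"] assms
    by (simp only: \<beta>_def[symmetric]) (simp add: power_mult_distrib ac_simps)
qed

text \<open>The factor is 1 - \<beta> / (t + 1)^2 up to higher order: \<beta> is visible under a
  quadratic weight and invisible under a linear one.\<close>

lemma powr_factor_tendsto:
  fixes \<beta> :: real
  shows "((\<lambda>t::real. (t + 1)^2 * ((1 - 1 / (t + 1)^2) powr \<beta> - 1)) \<longlongrightarrow> - \<beta>) at_top"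
    "((\<lambda>t::real. (t + 1) * ((1 - 1 / (t + 1)^2) powr \<beta> - 1)) \<longlongrightarrow> 0) at_top"
  by real_asymp+

text \<open>Centred at \<open>n + 1\<close>, so that no truncated \<open>n - 1\<close>
  occurs.\<close>

definition log_concave_at :: "real \<Rightarrow> nat \<Rightarrow> bool" where
  "log_concave_at \<alpha> n \<longleftrightarrow>
    (f (n + 1) / real (n + 1) powr \<alpha>) ^ 2 > (f (n + 2) / real (n + 2) powr \<alpha>) * (f n / real n powr \<alpha>)"

lemma u_product_tendsto:
  assumes "filterlim h at_top sequentially" "\<And>n. e 0 n = c0"
  shows "(\<lambda>m. u (h m + 2) * u (h m)) \<longlonglongrightarrow> c0 ^ 2"
proof -
  have "filterlim (\<lambda>m. h m + 2) at_top sequentially"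
    by (rule filterlim_at_top_mono[OF assms(1)]) simp
  then show ?thesis unfolding power2_eq_square
    by (intro tendsto_mult filterlim_compose[OF u_tendsto[OF assms(2)]] assms(1))
qed

text \<open>The inequality is weighted by (n + 1)^q and passes to the limit along the residue class
  of \<open>n\<close>, losing strictness. At order 1 it becomes a concavity condition; at order 2
  the power factor leaves an allowance depending on \<alpha>.\<close>

lemma log_concave_imp_second_difference:
  assumes lc: "\<forall>\<^sub>F n in sequentially. log_concave_at \<alpha> n" and q: "q = 1 \<or> q = 2"
    and const: "\<And>i n. i < q \<Longrightarrow> e i n = c i"
  shows "c 0 * (2 * e q (n + 1) - e q (n + 2) - e q n) \<ge> (if q = 1 then 0 else - (real k - 1 - \<alpha>) * c 0 ^ 2)"
proof -
  define h where "h m = n + m * L" for m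
  define \<beta> where "\<beta> = real k - 1 - \<alpha>"
  have h: "filterlim h at_top sequentially"
    by (rule filterlim_at_top_mono[OF filterlim_ident]) (use L_pos in \<open>auto simp: h_def intro!: always_eventually trans_le_add2\<close>)
  have t: "filterlim (\<lambda>m. real (h m)) at_top sequentially"
    by (rule filterlim_compose[OF filterlim_real_sequentially h])
  have per: "e q (h m + s) = e q (n + s)" for m s
  proof -
    have "h m + s = (n + s) + m * L" by (simp add: h_def)
    then show ?thesis by (simp only: periodic_mult[of "e q" L, OF e_periodic])
  qed
  have c0: "e 0 n = c 0" for n using const[of 0] q by auto
  have 1: "(\<lambda>m. real (h m + 1) ^ q * ((u (h m + 1))^2 - u (h m + 2) * u (h m)))
      \<longlonglongrightarrow> c 0 * (2 * e q (n + 1) - e q (n + 2) - e q n)"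
    by (rule scaled_second_difference_tendsto[OF h q const])
      (use per[of _ 0] per[of _ 1] per[of _ 2] in \<open>simp_all only: add_0_right\<close>)
  have w: "((\<lambda>t::real. (t + 1) ^ q * ((1 - 1 / (t + 1)^2) powr \<beta> - 1)) \<longlongrightarrow> (if q = 1 then 0 else - \<beta>)) at_top"
    using q powr_factor_tendsto[of \<beta>] by (cases "q = 1") simp_all
  have 2: "(\<lambda>m. u (h m + 2) * u (h m) * ((real (h m) + 1) ^ q * ((1 - 1 / (real (h m) + 1)^2) powr \<beta> - 1)))
      \<longlonglongrightarrow> c 0 ^ 2 * (if q = 1 then 0 else - \<beta>)"
    by (intro tendsto_mult u_product_tendsto h filterlim_compose[OF w t] c0)
  have "c 0 ^ 2 * (if q = 1 then 0 else - \<beta>) \<le> c 0 * (2 * e q (n + 1) - e q (n + 2) - e q n)"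
  proof (rule tendsto_le[OF _ 1 2])
    have "\<forall>\<^sub>F m in sequentially. log_concave_at \<alpha> (h m) \<and> h m > 0"
      by (rule eventually_compose_filterlim[OF eventually_conj[OF lc eventually_gt_at_top[of 0]] h])
    then show "\<forall>\<^sub>F m in sequentially. u (h m + 2) * u (h m) * ((real (h m) + 1) ^ q * ((1 - 1 / (real (h m) + 1)^2) powr \<beta> - 1))
        \<le> real (h m + 1) ^ q * ((u (h m + 1))^2 - u (h m + 2) * u (h m))"
    proof eventually_elim
      case (elim m)
      then have "u (h m + 2) * u (h m) * ((1 - 1 / (real (h m) + 1)^2) powr \<beta> - 1) \<le> (u (h m + 1))^2 - u (h m + 2) * u (h m)"
        using log_concave_iff[of "h m" \<alpha>] by (simp add: log_concave_at_def \<beta>_def algebra_simps)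
      then have "(real (h m) + 1) ^ q * (u (h m + 2) * u (h m) * ((1 - 1 / (real (h m) + 1)^2) powr \<beta> - 1))
          \<le> (real (h m) + 1) ^ q * ((u (h m + 1))^2 - u (h m + 2) * u (h m))"
        by (rule mult_left_mono) simp
      then show ?case by (simp add: ac_simps)
    qed
  qed simp
  then show ?thesis by (simp add: \<beta>_def algebra_simps split: if_splits)
qed

lemma eventually_log_concave:
  assumes const: "\<And>i n. i < 3 \<Longrightarrow> e i n = c i" and "c 0 \<noteq> 0" "\<alpha> < real k - 1"
  shows "\<forall>\<^sub>F n in sequentially. log_concave_at \<alpha> n"
proof -
  define \<beta> where "\<beta> = real k - 1 - \<alpha>"
  have 1: "(\<lambda>m. real (m + 1) ^ 2 * ((u (m + 1))^2 - u (m + 2) * u m)) \<longlonglongrightarrow> c 0 * (2 * c 2 - c 2 - c 2)"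
    by (rule scaled_second_difference_tendsto) (use const filterlim_ident in auto)
  have 2: "(\<lambda>m. u (m + 2) * u m * ((real m + 1) ^ 2 * ((1 - 1 / (real m + 1)^2) powr \<beta> - 1))) \<longlonglongrightarrow> c 0 ^ 2 * (- \<beta>)"
    by (intro tendsto_mult u_product_tendsto filterlim_compose[OF powr_factor_tendsto(1) filterlim_real_sequentially])
      (use const filterlim_ident in auto)
  \<comment> \<open>With \<open>e 2\<close> constant the second difference tends to 0 even at order
    2, so this gap alone decides the sign.\<close>
  have "c 0 ^ 2 * \<beta> > 0" using assms(2,3) by (simp add: \<beta>_def)
  then have "\<forall>\<^sub>F m in sequentially. real (m + 1) ^ 2 * ((u (m + 1))^2 - u (m + 2) * u m) -
      u (m + 2) * u m * ((real m + 1) ^ 2 * ((1 - 1 / (real m + 1)^2) powr \<beta> - 1)) > 0"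
    using order_tendstoD(1)[OF tendsto_diff[OF 1 2], of 0] by simp
  then show ?thesis using eventually_gt_at_top[of 0]
  proof eventually_elim
    case (elim m)
    have "(real m + 1)^2 * ((u (m + 1))^2 - u (m + 2) * u m * (1 - 1 / (real m + 1)^2) powr \<beta>) > 0"
      using elim(1) by (simp add: algebra_simps)
    then have "(u (m + 1))^2 - u (m + 2) * u m * (1 - 1 / (real m + 1)^2) powr \<beta> > 0"
      by (simp add: zero_less_mult_iff)
    then show ?case using log_concave_iff[OF elim(2), of \<alpha>] by (simp add: log_concave_at_def \<beta>_def)
  qed
qed

end

section \<open>Second differences of periodic sequences\<close>

text \<open>Concavity makes the increments weakly decreasing, periodicity makes them constant, and a
  constant increment of a periodic sequence is 0.\<close>

lemma periodic_concave_constant: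
  fixes f :: "nat \<Rightarrow> real"
  assumes per: "\<And>n. f (n + L) = f n" and L: "L > 0"
    and concave: "\<And>n. f (n + 2) - 2 * f (n + 1) + f n \<le> 0"
  shows "f n = f 0"
proof -
  define g where "g n = f (n + 1) - f n" for n
  have g_per: "g (n + L) = g n" for n using per[of n] per[of "n + 1"] by (simp add: g_def)
  have "g (Suc n) \<le> g n" for n using concave[of n] by (simp add: g_def)
  then have anti: "g m \<le> g n" if "n \<le> m" for m n using that by (rule lift_Suc_antimono_le)
  have "g n = g 0" for n
  proof (rule antisym)
    show "g n \<le> g 0" by (rule anti) simp
    have "g 0 = g (n * L)" using periodic_mult[of g L 0 n, OF g_per] by simp
    also have "\<dots> \<le> g n" using L by (intro anti) simp
    finally show "g 0 \<le> g n" .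
  qed
  then have "f (n + 1) = f n + g 0" for n by (simp add: g_def algebra_simps)
  moreover from this have "g 0 = 0" by (rule periodic_increment_eq_0[of f L 1, OF per L])
  ultimately have "f (Suc n) = f n" for n by simp
  then show ?thesis by (induction n) auto
qed

text \<open>Telescoping in both directions. With \<open>k\<close> and \<open>l\<close> inverse to
  \<open>x\<close> and \<open>y\<close> modulo a period, the right-hand side becomes an ordinary
  second difference.\<close>

lemma sum_second_telescope:
  fixes f :: "nat \<Rightarrow> real"
  shows "(\<Sum>i<k. \<Sum>j<l. f (n + i * x + j * y + x + y) - f (n + i * x + j * y + y) - f (n + i * x + j * y + x) + f (n + i * x + j * y))
    = f (n + k * x + l * y) - f (n + l * y) - f (n + k * x) + f n"
proof -
  have inner: "(\<Sum>j<l. f (m + j * y + x + y) - f (m + j * y + y) - f (m + j * y + x) + f (m + j * y))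
      = (f (m + x + l * y) - f (m + l * y)) - (f (m + x) - f m)" for m
    using sum_lessThan_telescope[of "\<lambda>j. f (m + x + j * y) - f (m + j * y)" l] by (simp add: algebra_simps)
  have "(\<Sum>i<k. \<Sum>j<l. f (n + i * x + j * y + x + y) - f (n + i * x + j * y + y) - f (n + i * x + j * y + x) + f (n + i * x + j * y))
      = (\<Sum>i<k. (f (n + Suc i * x + l * y) - f (n + Suc i * x)) - (f (n + i * x + l * y) - f (n + i * x)))"
  proof (intro sum.cong refl)
    fix i
    have "n + Suc i * x = n + i * x + x" by simp
    then show "(\<Sum>j<l. f (n + i * x + j * y + x + y) - f (n + i * x + j * y + y) - f (n + i * x + j * y + x) + f (n + i * x + j * y))
        = (f (n + Suc i * x + l * y) - f (n + Suc i * x)) - (f (n + i * x + l * y) - f (n + i * x))"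
      by (simp only: inner)
  qed
  also have "\<dots> = f (n + k * x + l * y) - f (n + k * x) - (f (n + l * y) - f n)"
    using sum_lessThan_telescope[of "\<lambda>i. f (n + i * x + l * y) - f (n + i * x)" k] by simp
  finally show ?thesis by simp
qed

text \<open>Up to the factor \<open>K\<close>, the mixed difference of the averages of \<open>e\<close> over the classes modulo \<open>q\<close>
  equals \<open>q - 1\<close> on one class and \<open>-1\<close> on the others. Since \<open>x\<close> and \<open>y\<close> are invertible modulo \<open>q\<close>,
  the second difference with step one is a sum of such terms, hence integral, and it is not
  divisible by \<open>q\<close>; having mean zero, it is at least one somewhere.\<close>

lemma mean_second_difference_not_small:
  fixes e :: "nat \<Rightarrow> real"
  assumes per: "\<And>n. e (n + L) = e n" and L: "L > 0"
    and q: "prime q" "\<not> q dvd x" "\<not> q dvd y" and K: "K > 0"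
    and mixed: "\<And>n. \<not> q dvd n + x + y \<Longrightarrow> e (n + x + y) - e (n + y) - e (n + x) + e n = - K"
    and small: "\<And>n. e (n + 2) - 2 * e (n + 1) + e n < K"
  shows False
proof -
  \<comment> \<open>Summing \<open>L\<close> terms in steps of \<open>q\<close> gives period
    \<open>q\<close>, since \<open>L q\<close> is a period of \<open>e\<close>; the divisor turns a
    mixed difference \<open>-K\<close> into -1.\<close>
  define s where "s n = (\<Sum>t<L. e (n + t * q)) / (real L * K)" for n
  have LK: "real L * K > 0" using L K by simp
  have q0: "q > 1" using q(1) by (rule prime_gt_1_nat)
  have s_per: "s (n + q) = s n" for n
  proof -
    have "e (n + (t + L) * q) = e (n + t * q)" for t
      using periodic_mult[of e L "n + t * q" q, OF per] by (simp add: algebra_simps)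
    then have "(\<Sum>t<L. e (n + (t + 1) * q)) = (\<Sum>t<L. e (n + t * q))"
      using sum_periodic_shift[of "\<lambda>t. e (n + t * q)" L 1] by simp
    then show ?thesis by (simp add: s_def algebra_simps)
  qed
  have s_mult: "s (n + m * q) = s n" for n m by (rule periodic_mult[of s, OF s_per])
  have s_small: "s (n + 2) - 2 * s (n + 1) + s n < 1" for n
  proof -
    have "(\<Sum>t<L. e (n + t * q + 2) - 2 * e (n + t * q + 1) + e (n + t * q)) < (\<Sum>t<L. K)"
      using L by (intro sum_strict_mono small) auto
    then have "(\<Sum>t<L. e (n + 2 + t * q)) - 2 * (\<Sum>t<L. e (n + 1 + t * q)) + (\<Sum>t<L. e (n + t * q)) < real L * K"
      by (simp add: sum.distrib sum_subtractf sum_distrib_left add_ac)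
    then have "((\<Sum>t<L. e (n + 2 + t * q)) - 2 * (\<Sum>t<L. e (n + 1 + t * q)) + (\<Sum>t<L. e (n + t * q))) / (real L * K) < 1"
      using LK by (simp only: divide_less_eq_1_pos)
    then show ?thesis by (simp add: s_def add_divide_distrib diff_divide_distrib)
  qed
  define g where "g n = s (n + x + y) - s (n + y) - s (n + x) + s n" for n
  have g_per: "g (n + q) = g n" for n
    using s_per[of n] s_per[of "n + x"] s_per[of "n + y"] s_per[of "n + x + y"]
    by (simp add: g_def add_ac)
  have g_mult: "g (n + m * q) = g n" for n m by (rule periodic_mult[of g, OF g_per])
  have g_neg: "g n = -1" if "\<not> q dvd n + x + y" for n
  proof -
    have "\<not> q dvd (n + t * q) + x + y" for t
      using that dvd_add_left_iff[of q "t * q" "n + x + y"] by (simp add: add_ac)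
    then have "(\<Sum>t<L. e (n + t * q + x + y) - e (n + t * q + y) - e (n + t * q + x) + e (n + t * q)) = (\<Sum>t<L. - K)"
      by (intro sum.cong mixed) auto
    then have "(\<Sum>t<L. e (n + x + y + t * q)) - (\<Sum>t<L. e (n + y + t * q)) - (\<Sum>t<L. e (n + x + t * q)) + (\<Sum>t<L. e (n + t * q)) = - (real L * K)"
      by (simp add: sum.distrib sum_subtractf add_ac)
    then have "((\<Sum>t<L. e (n + x + y + t * q)) - (\<Sum>t<L. e (n + y + t * q)) - (\<Sum>t<L. e (n + x + t * q)) + (\<Sum>t<L. e (n + t * q))) / (real L * K) = - 1"
      using L K by (simp only: divide_minus_left) simp
    then show ?thesis by (simp add: g_def s_def add_divide_distrib diff_divide_distrib)
  qed
  \<comment> \<open>A shift normalising the exceptional class: \<open>n + w + x + y\<close> is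
    congruent to \<open>n\<close> modulo \<open>q\<close>.\<close>
  define w where "w = (x + y) * (q - 1)"
  have w: "n + w + x + y = n + (x + y) * q" for n
    using q0 by (cases q) (simp_all add: w_def)
  have g_w: "g w = real q - 1"
  proof -
    have z: "(\<Sum>n<q. s (n + t)) = (\<Sum>n<q. s n)" for t by (rule sum_periodic_shift[of s, OF s_per])
    \<comment> \<open>All shifts of \<open>s\<close> have the same sum over a period, so the
      exceptional value of \<open>g\<close> balances \<open>q - 1\<close> values -1.\<close>
    have "(\<Sum>n<q. g (n + w)) = 0"
      using z[of "w + x + y"] z[of "w + y"] z[of "w + x"] z[of w]
      by (simp add: g_def sum.distrib sum_subtractf add_ac)
    moreover have "{..<q} = insert 0 {1..<q}" using q0 by auto
    then have "(\<Sum>n<q. g (n + w)) = g w + (\<Sum>n\<in>{1..<q}. g (n + w))" by simp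
    moreover have "(\<Sum>n\<in>{1..<q}. g (n + w)) = (\<Sum>n\<in>{1..<q}. -1)"
    proof (intro sum.cong g_neg)
      fix n assume "n \<in> {1..<q}"
      then have "\<not> q dvd n" by (auto dest: dvd_imp_le)
      then show "\<not> q dvd n + w + x + y" by (simp add: w)
    qed simp
    ultimately show ?thesis using q0 by (simp add: of_nat_diff)
  qed
  define \<delta> where "\<delta> n = (if q dvd n then int q - 1 else - 1)" for n
  have g_chi: "g n = of_int (\<delta> (n + x + y))" for n
  proof (cases "q dvd n + x + y")
    case True
    then obtain m where m: "n + x + y = q * m" by (elim dvdE)
    have "n + (x + y) * q = w + m * q" using w[of n] m by (simp add: algebra_simps)
    then have "g n = g w" using g_mult[of n "x + y"] g_mult[of w m] by simp
    then show ?thesis using g_w True by (simp add: \<delta>_def)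
  next
    case False
    then show ?thesis using g_neg by (simp add: \<delta>_def)
  qed
  have inverse: "\<exists>z' m. z' * z = m * q + 1" if "\<not> q dvd z" for z
  proof -
    have "gcd z q = 1" using q(1) that by (metis coprime_iff_gcd_eq_1 coprime_commute prime_imp_coprime)
    moreover have "z \<noteq> 0" using that by (metis dvd_0_right)
    ultimately show ?thesis using bezout_nat[of z q] by (metis mult.commute)
  qed
  obtain x' mx where x': "x' * x = mx * q + 1" using inverse[OF q(2)] by blast
  obtain y' my where y': "y' * y = my * q + 1" using inverse[OF q(3)] by blast
  define X where "X n = (\<Sum>i<x'. \<Sum>j<y'. \<delta> (n + i * x + j * y + x + y))" for n
  have X: "of_int (X n) = s (n + 2) - 2 * s (n + 1) + s n" for n
  proof -
    have "of_int (X n) = (\<Sum>i<x'. \<Sum>j<y'. g (n + i * x + j * y))"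
      by (simp add: X_def g_chi)
    also have "\<dots> = s (n + x' * x + y' * y) - s (n + y' * y) - s (n + x' * x) + s n"
      unfolding g_def by (rule sum_second_telescope)
    finally have sum: "of_int (X n) = s (n + x' * x + y' * y) - s (n + y' * y) - s (n + x' * x) + s n" .
    have "n + x' * x + y' * y = (n + 2) + (mx + my) * q" using x' y' by (simp add: add_mult_distrib)
    then have "s (n + x' * x + y' * y) = s (n + 2)" by (simp only: s_mult)
    moreover have "n + x' * x = (n + 1) + mx * q" by (simp add: x')
    then have "s (n + x' * x) = s (n + 1)" by (simp only: s_mult)
    moreover have "n + y' * y = (n + 1) + my * q" by (simp add: y')
    then have "s (n + y' * y) = s (n + 1)" by (simp only: s_mult)
    ultimately show ?thesis using sum by simp
  qed
  \<comment> \<open>An integer below 1 is at most 0; since the values over a period add up to 0,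
    each of them is 0.\<close>
  have X_le: "X n \<le> 0" for n
    using s_small[of n] X[of n] by linarith
  have "(\<Sum>n<q. s (n + 2) - 2 * s (n + 1) + s n) = 0"
    using sum_periodic_shift[of s q 2, OF s_per] sum_periodic_shift[of s q 1, OF s_per]
    by (simp add: sum.distrib sum_subtractf flip: sum_distrib_left)
  then have "real_of_int (\<Sum>n<q. X n) = 0" by (simp only: of_int_sum X)
  then have "(\<Sum>n<q. X n) = 0" by (simp only: of_int_eq_0_iff)
  then have "(\<Sum>n<q. - X n) = 0" by (simp add: sum_negf)
  then have "X 0 = 0"
    using sum_nonneg_0[of "{..<q}" "\<lambda>n. - X n" 0] X_le q0 by simp
  \<comment> \<open>Every value of \<open>\<delta>\<close> is -1 modulo \<open>q\<close>, so
    \<open>X 0\<close> is congruent to the negative of the product of \<open>x'\<close> and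
    \<open>y'\<close>, which are units modulo \<open>q\<close>.\<close>
  moreover have "int q dvd (\<Sum>i<x'. \<Sum>j<y'. \<delta> (0 + i * x + j * y + x + y) + 1)"
    by (intro dvd_sum) (simp add: \<delta>_def)
  ultimately have "int q dvd int x' * int y'"
    by (simp add: X_def sum.distrib)
  then have "q dvd x' \<or> q dvd y'"
    using q(1) by (metis int_dvd_int_iff of_nat_mult prime_dvd_mult_iff)
  then have "q dvd mx * q + 1 \<or> q dvd my * q + 1" by (metis x' y' dvd_mult2)
  then show False using q0 by (metis dvd_add_right_iff dvd_triv_right nat_dvd_1_iff_1 less_irrefl)
qed

text \<open>For \<open>k \<ge> 2\<close> the left-hand side consists of three distinct terms of the
  binomial expansion. The surplus 1 later yields a fixed loss at every step.\<close>

lemma power_Suc_ge_with_remainder: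
  fixes x :: real
  assumes "x \<ge> 0" "k \<ge> 2"
  shows "x ^ k + real k * x ^ (k - 1) + 1 \<le> (x + 1) ^ k"
  using assms(2)
proof (induction k rule: dec_induct)
  case base
  then show ?case by (simp add: power2_eq_square algebra_simps)
next
  case (step k)
  have "x ^ Suc k + real (Suc k) * x ^ k + 1 \<le> (x ^ k + real k * x ^ (k - 1) + 1) * (x + 1)"
  proof -
    have "x ^ k = x * x ^ (k - 1)" using step by (simp add: power_eq_if)
    then have "(x ^ k + real k * x ^ (k - 1) + 1) * (x + 1) = x ^ Suc k + real (Suc k) * x ^ k + 1 + (real k * x ^ (k - 1) + x)"
      by (simp add: algebra_simps)
    then show ?thesis using assms(1) by simp
  qed
  also have "\<dots> \<le> (x + 1) ^ k * (x + 1)" using step.IH assms(1) by (intro mult_right_mono) auto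
  finally show ?case by (simp add: mult.commute)
qed

subsection \<open>The partition function\<close>

locale partition_expansion =
  fixes a :: "'i \<Rightarrow> nat" and I :: "'i set" and L :: nat and P :: "nat \<Rightarrow> real poly"
  assumes fin: "finite I" and nonempty: "I \<noteq> {}" and pos: "\<And>i. i \<in> I \<Longrightarrow> a i > 0"
    and dvd_L: "\<And>i. i \<in> I \<Longrightarrow> a i dvd L" and L_pos: "L > 0"
    and quasi: "quasi_poly L (\<lambda>n. real (part_count a I n)) P"
    and vanish: "\<And>n j. j \<ge> card I \<Longrightarrow> coeff (P n) j = 0"
begin

sublocale quasi_poly_expansion "\<lambda>n. real (part_count a I n)" L "card I" P
  using fin nonempty quasi vanish L_pos by unfold_locales (auto simp: card_gt_0_iff)

definition divisible :: "nat \<Rightarrow> 'i set" where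
  "divisible d = {i \<in> I. d dvd a i}"

text \<open>The derivative of the simplex volume n^k / (k! a_1 ... a_k) at n, divided by n^(k-1):
  the mean leading coefficient.\<close>

definition c\<^sub>0 :: real where
  "c\<^sub>0 = 1 / (fact (card I - 1) * (\<Prod>i\<in>I. real (a i)))"

lemma c0_pos: "c\<^sub>0 > 0"
proof -
  have "(\<Prod>i\<in>I. real (a i)) > 0" by (intro prod_pos) (use pos in auto)
  then show ?thesis by (simp add: c\<^sub>0_def)
qed

lemma e_constant:
  assumes "\<And>d. d \<ge> 2 \<Longrightarrow> card (divisible d) \<le> card I - Suc m" "i \<le> m"
  shows "e i n = e i 0"
proof (cases "i < card I")
  case True
  then show ?thesis
    using coeff_part_count_constant[OF fin pos dvd_L L_pos quasi vanish, of "card I - Suc m" "card I - 1 - i" n] assms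
    by (simp add: e_def divisible_def)
qed (simp add: e_def)

lemma e0_eq:
  assumes "\<And>d. d \<ge> 2 \<Longrightarrow> card (divisible d) \<le> card I - 1"
  shows "e 0 n = c\<^sub>0"
proof -
  have c: "coeff (P n) (card I - 1) = e 0 0" for n
    using e_constant[of 0 0 n] assms k_pos by (simp add: e_def)
  have "(\<Sum>n<L. coeff (P n) (card I - 1)) = real L * c\<^sub>0"
    using sum_leading_coeff_part_count[OF fin nonempty pos dvd_L L_pos quasi vanish] by (simp add: c\<^sub>0_def)
  then have "e 0 0 = c\<^sub>0" using L_pos by (simp only: c) simp
  then show ?thesis using e_constant[of 0 0 n] assms by simp
qed

lemma eventually_log_concave_if:
  assumes "\<And>d. d \<ge> 2 \<Longrightarrow> card (divisible d) \<le> card I - 3" "\<alpha> < real (card I) - 1"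
  shows "\<forall>\<^sub>F n in sequentially. log_concave_at \<alpha> n"
proof (rule eventually_log_concave[where c = "\<lambda>i. e i 0"])
  show "e i n = e i 0" if "i < 3" for i n
    using e_constant[of 2 i n] assms(1) that by (simp add: numeral_3_eq_3)
  have "card (divisible d) \<le> card I - 1" if "d \<ge> 2" for d
    using assms(1)[OF that] by simp
  then show "e 0 0 \<noteq> 0" using e0_eq[of 0] c0_pos by simp
qed (rule assms(2))

text \<open>A zero in the middle makes the larger side 0, while the smaller side is never
  negative.\<close>

lemma eventually_positive:
  assumes "\<forall>\<^sub>F n in sequentially. log_concave_at \<alpha> n"
  shows "\<forall>\<^sub>F n in sequentially. part_count a I n > 0"
proof -
  have "\<forall>\<^sub>F n in sequentially. part_count a I (Suc n) > 0"
    using assms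
  proof eventually_elim
    case (elim n)
    show ?case
    proof (rule ccontr)
      assume "\<not> part_count a I (Suc n) > 0"
      then have "0 > (real (part_count a I (n + 2)) / real (n + 2) powr \<alpha>) * (real (part_count a I n) / real n powr \<alpha>)"
        using elim by (simp add: log_concave_at_def)
      then show False by (simp add: mult_less_0_iff divide_less_0_iff)
    qed
  qed
  then show ?thesis by (rule eventually_sequentially_Suc[THEN iffD1])
qed

section \<open>Divisibility conditions forced by log-concavity\<close>

lemma card_divisible_less:
  assumes lc: "\<forall>\<^sub>F n in sequentially. log_concave_at \<alpha> n" and d: "d \<ge> 2"
  shows "card (divisible d) \<le> card I - 1"
proof -
  have "divisible d \<noteq> I"
  proof
    assume *: "divisible d = I"
    obtain N where N: "\<And>n. n \<ge> N \<Longrightarrow> part_count a I n > 0"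
      using eventually_positive[OF lc] by (auto simp: eventually_sequentially)
    have "\<not> d dvd d * N + 1" using d by (metis dvd_add_right_iff dvd_triv_left nat_dvd_1_iff_1 numeral_le_one_iff semiring_norm(69))
    then have "part_count a I (d * N + 1) = 0"
      by (intro part_count_eq_0_if_not_dvd[of I d]) (use * in \<open>auto simp: divisible_def\<close>)
    moreover have "N \<le> d * N + 1" using d by (cases d) auto
    ultimately show False using N[of "d * N + 1"] by simp
  qed
  then have "card (divisible d) < card I"
    using fin by (intro psubset_card_mono) (auto simp: divisible_def)
  then show ?thesis by simp
qed

text \<open>Multiples of \<open>d\<close> add up to multiples of \<open>d\<close>, and
  \<open>d\<close> divides \<open>L\<close>, so the count vanishes on the whole residue class of
  \<open>n\<close>.\<close>

lemma part_count_poly_eq_0: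
  assumes "quasi_poly L (\<lambda>n. real (part_count a B n)) R" "B \<noteq> {}" "B \<subseteq> divisible d" "\<not> d dvd n"
  shows "R n = 0"
proof (rule poly_eq_if_agree_on_progression[OF L_pos])
  fix m :: nat assume m: "m > 0"
  obtain b where "b \<in> B" using assms(2) by blast
  then have "d dvd L" using assms(3) dvd_L by (auto simp: divisible_def intro: dvd_trans)
  then have "\<not> d dvd n + m * L" using assms(4) by (simp add: dvd_add_left_iff)
  then have "part_count a B (n + m * L) = 0"
    by (rule part_count_eq_0_if_not_dvd[rotated]) (use assms(3) in \<open>auto simp: divisible_def\<close>)
  moreover have "n + m * L > 0" using m L_pos by simp
  then have "real (part_count a B (n + m * L)) = poly (R (n + m * L)) (real (n + m * L))"
    using assms(1) by (simp only: quasi_poly_def)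
  moreover have "R (n + m * L) = R n"
    using assms(1) by (intro periodic_mult) (simp add: quasi_poly_def)
  ultimately show "poly (R n) (real (n + m * L)) = poly 0 (real (n + m * L))" by simp
qed

lemma exists_poly_subset:
  assumes "B \<subseteq> I"
  obtains R where "quasi_poly L (\<lambda>n. real (part_count a B n)) R" "\<And>n j. j \<ge> card B \<Longrightarrow> coeff (R n) j = 0"
  using exists_quasi_poly_part_count[of B a L] assms fin pos dvd_L L_pos
  by (metis finite_subset subsetD)

lemma difference_subset:
  assumes "insert i B \<subseteq> I" "i \<notin> B"
    and "quasi_poly L (\<lambda>n. real (part_count a (insert i B) n)) Q"
    and "quasi_poly L (\<lambda>n. real (part_count a B n)) R"
  shows "pcompose (Q (n + a i)) [:real (a i), 1:] - Q n = pcompose (R (n + a i)) [:real (a i), 1:]"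
  by (rule quasi_poly_part_count_difference[of B i a L])
    (use assms fin pos L_pos in \<open>auto intro: finite_subset\<close>)

text \<open>Suppose \<open>d\<close> misses only the part \<open>i\<close>. Without \<open>i\<close>
  the polynomial is 0 off the multiples of \<open>d\<close>, so the difference in step
  \<open>a i\<close> vanishes there. With the two top coefficients constant, however, that
  difference has coefficient \<open>c\<^sub>0 (k + 1) a i > 0\<close> at x^k, where
  \<open>k = card I - 2\<close>.\<close>

lemma card_divisible_le_minus_2:
  assumes lc: "\<forall>\<^sub>F n in sequentially. log_concave_at \<alpha> n" and card: "card I \<ge> 2" and d: "d \<ge> 2"
  shows "card (divisible d) \<le> card I - 2"
proof (rule ccontr)
  assume "\<not> card (divisible d) \<le> card I - 2"
  then have cB: "card (divisible d) = card I - 1" using card_divisible_less[OF lc d] by simp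
  have c0: "e 0 n = c\<^sub>0" for n by (rule e0_eq) (rule card_divisible_less[OF lc])
  have "c\<^sub>0 * (2 * e 1 (n + 1) - e 1 (n + 2) - e 1 n) \<ge> 0" for n
    using log_concave_imp_second_difference[OF lc, of 1 "\<lambda>_. c\<^sub>0" n] c0 by simp
  then have "e 1 (n + 2) - 2 * e 1 (n + 1) + e 1 n \<le> 0" for n
    using c0_pos by (simp add: zero_le_mult_iff) (smt (verit) zero_le_mult_iff)
  then have c1: "e 1 n = e 1 0" for n
    using periodic_concave_constant[of "e 1" L] e_periodic L_pos by simp
  define k where "k = card I - 2"
  have k: "card I = Suc (Suc k)" using card by (simp add: k_def)
  have B: "divisible d \<subseteq> I" by (auto simp: divisible_def)
  have "card (I - divisible d) = 1"
    using cB k B fin by (simp add: card_Diff_subset finite_subset)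
  then obtain i where i: "I - divisible d = {i}" by (auto simp: card_1_singleton_iff)
  then have I: "I = insert i (divisible d)" "i \<notin> divisible d" using B by auto
  obtain R where R: "quasi_poly L (\<lambda>n. real (part_count a (divisible d) n)) R"
    by (rule exists_poly_subset[OF B])
  \<comment> \<open>Chosen so that \<open>n + a i\<close> is 1 modulo \<open>d\<close>.\<close>
  define n where "n = a i * (d - 1) + 1"
  have n: "n + a i = a i * d + 1" using d by (cases d) (simp_all add: n_def)
  have nd: "\<not> d dvd n + a i" unfolding n using d by (metis dvd_add_right_iff dvd_triv_right nat_dvd_1_iff_1 numeral_le_one_iff semiring_norm(69))
  have "R (n + a i) = 0"
    by (rule part_count_poly_eq_0[OF R, of d]) (use nd cB k in auto)
  moreover have "pcompose (P (n + a i)) [:real (a i), 1:] - P n = pcompose (R (n + a i)) [:real (a i), 1:]"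
    by (rule difference_subset[OF _ I(2) _ R]) (use I(1) quasi in simp_all)
  ultimately have "pcompose (P (n + a i)) [:real (a i), 1:] - P n = 0" by simp
  from arg_cong[OF this, of "\<lambda>p. coeff p k"]
  have "coeff (pcompose (P (n + a i)) [:real (a i), 1:]) k - coeff (P n) k = 0" by simp
  moreover have "{k<..<card I} = {Suc k}" using k by auto
  then have "coeff (pcompose (P (n + a i)) [:real (a i), 1:]) k = coeff (P (n + a i)) k + coeff (P (n + a i)) (Suc k) * (real k + 1) * real (a i)"
    using coeff_shift_split[of "card I" "P (n + a i)" "real (a i)" k] vanish by simp
  moreover have "coeff (P m) (Suc k) = c\<^sub>0" for m using c0[of m] unfolding e_def by (simp add: k)
  moreover have "coeff (P m) k = e 1 0" for m using c1[of m] unfolding e_def by (simp add: k)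
  ultimately have "c\<^sub>0 * (real k + 1) * real (a i) = 0" by simp
  moreover have "real (a i) > 0" using I pos by (metis insertI1 of_nat_0_less_iff)
  ultimately show False using c0_pos by simp
qed

text \<open>Passing to a prime factor \<open>q\<close> of \<open>d\<close> makes the two parts it
  misses invertible modulo \<open>q\<close>. Removing both leaves the zero polynomial off the
  multiples of \<open>q\<close>, which determines the mixed difference of \<open>e 2\<close>
  there.\<close>

lemma card_divisible_le_minus_3:
  assumes lc: "\<forall>\<^sub>F n in sequentially. log_concave_at \<alpha> n" and card: "card I \<ge> 3" and d: "d \<ge> 2"
    and alpha: "\<alpha> > 0"
  shows "card (divisible d) \<le> card I - 3"
proof (rule ccontr)
  assume *: "\<not> card (divisible d) \<le> card I - 3"
  obtain q where q: "prime q" "q dvd d" using d by (metis One_nat_def Suc_1 not_less_eq_eq order_refl prime_factor_nat)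
  have q2: "q \<ge> 2" using q(1) by (rule prime_ge_2_nat)
  have le2: "card (divisible d) \<le> card I - 2" if "d \<ge> 2" for d
    by (rule card_divisible_le_minus_2[OF lc _ that]) (use card in simp)
  have "card (divisible d) \<le> card (divisible q)"
    using fin q(2) by (intro card_mono) (auto simp: divisible_def intro: dvd_trans)
  then have cB: "card (divisible q) = card I - 2" using * le2[OF q2] by simp
  have c0: "e 0 n = c\<^sub>0" for n by (rule e0_eq) (rule card_divisible_less[OF lc])
  have c1: "e 1 n = e 1 0" for n
    by (rule e_constant[of 1]) (use le2 in \<open>auto simp: numeral_2_eq_2\<close>)
  have D2: "c\<^sub>0 * (2 * e 2 (n + 1) - e 2 (n + 2) - e 2 n) \<ge> - (real (card I) - 1 - \<alpha>) * c\<^sub>0 ^ 2" for n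
    using log_concave_imp_second_difference[OF lc, of 2 "\<lambda>i. e i 0" n] c0 c1
    by (simp add: less_2_cases_iff) (metis One_nat_def c0 c1 less_2_cases)
  define k where "k = card I - 3"
  have k: "card I = Suc (Suc (Suc k))" using card by (simp add: k_def)
  have B: "divisible q \<subseteq> I" by (auto simp: divisible_def)
  have "card (I - divisible q) = 2"
    using cB k B fin by (simp add: card_Diff_subset finite_subset)
  then obtain i j where ij: "I - divisible q = {i, j}" "i \<noteq> j" by (auto simp: card_2_iff)
  define B1 where "B1 = insert j (divisible q)"
  have I: "I = insert i B1" "i \<notin> B1" "B1 \<subseteq> I" "j \<notin> divisible q" using B ij by (auto simp: B1_def)
  have cB1: "card B1 = Suc (Suc k)"
    using fin I k by (metis card_insert_disjoint finite_subset nat.inject)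
  have nd: "\<not> q dvd a i" "\<not> q dvd a j" using ij by (auto simp: divisible_def)
  have ai: "a i > 0" "a j > 0" using ij pos by auto
  obtain R where R: "quasi_poly L (\<lambda>n. real (part_count a (divisible q) n)) R"
    by (rule exists_poly_subset[OF B])
  obtain Q where Q: "quasi_poly L (\<lambda>n. real (part_count a B1 n)) Q" and Q0: "\<And>n j. j \<ge> card B1 \<Longrightarrow> coeff (Q n) j = 0"
    using exists_poly_subset[OF I(3)] by blast
  have rel1: "pcompose (P (n + a i)) [:real (a i), 1:] - P n = pcompose (Q (n + a i)) [:real (a i), 1:]" for n
    by (rule difference_subset[OF _ I(2) _ Q]) (use I(1) quasi in simp_all)
  have rel2: "pcompose (Q (n + a j)) [:real (a j), 1:] - Q n = pcompose (R (n + a j)) [:real (a j), 1:]" for n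
    by (rule difference_subset[OF I(3)[unfolded B1_def] I(4) Q[unfolded B1_def] R])
  have P2: "coeff (P m) (Suc (Suc k)) = c\<^sub>0" for m using c0[of m] unfolding e_def by (simp add: k)
  have P1: "coeff (P m) (Suc k) = e 1 0" for m using c1[of m] unfolding e_def by (simp add: k)
  have P0: "coeff (P m) k = e 2 m" for m unfolding e_def by (simp add: k)
  have sets: "{k<..<card I} = {Suc k, Suc (Suc k)}" "{Suc k<..<card I} = {Suc (Suc k)}"
      "{k<..<card B1} = {Suc k}" "{Suc k<..<card B1} = {}" using k cB1 by auto
  have shiftP: "coeff (pcompose (P m) [:t, 1:]) j = coeff (P m) j + (\<Sum>i\<in>{j<..<card I}. coeff (P m) i * real (i choose j) * t ^ (i - j))" for m t j
    by (rule coeff_shift_split) (use vanish in auto)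
  have shiftQ: "coeff (pcompose (Q m) [:t, 1:]) j = coeff (Q m) j + (\<Sum>i\<in>{j<..<card B1}. coeff (Q m) i * real (i choose j) * t ^ (i - j))" for m t j
    by (rule coeff_shift_split) (use Q0 in auto)
  have Q1: "coeff (Q (n + a i)) (Suc k) = c\<^sub>0 * (real k + 2) * real (a i)" for n
    using arg_cong[OF rel1[of n], of "\<lambda>p. coeff p (Suc k)"]
    by (simp add: shiftP shiftQ sets P1 P2 add.commute)
  \<comment> \<open>The share of coefficient \<open>k\<close> of \<open>Q\<close> that does not
    depend on \<open>n\<close>; it cancels in the mixed difference.\<close>
  define K1 where "K1 = e 1 0 * (1 + real k) * real (a i) + c\<^sub>0 * real (Suc (Suc k) choose k) * real (a i) ^ 2
    - c\<^sub>0 * (real k + 2) * real (a i) * (1 + real k) * real (a i)"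
  have Qk: "coeff (Q (n + a i)) k = e 2 (n + a i) - e 2 n + K1" for n
  proof -
    have "coeff (pcompose (P (n + a i)) [:real (a i), 1:]) k = e 2 (n + a i) +
        (e 1 0 * (1 + real k) * real (a i) + c\<^sub>0 * real (Suc (Suc k) choose k) * real (a i) ^ 2)"
      by (simp add: shiftP sets P0 P1 P2 numeral_2_eq_2 del: binomial_Suc_Suc)
    moreover have "coeff (pcompose (Q (n + a i)) [:real (a i), 1:]) k = coeff (Q (n + a i)) k +
        c\<^sub>0 * (real k + 2) * real (a i) * (1 + real k) * real (a i)"
      by (simp add: shiftQ sets Q1)
    ultimately show ?thesis using arg_cong[OF rel1[of n], of "\<lambda>p. coeff p k"]
      by (simp add: K1_def P0)
  qed
  \<comment> \<open>\<open>a i\<close> times \<open>a j\<close> times the coefficient in the second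
    derivative of the leading term \<open>c\<^sub>0\<close> x^(k+2), as
    \<open>k + 2 = card I - 1\<close>.\<close>
  define K where "K = c\<^sub>0 * (real k + 2) * (real k + 1) * real (a i) * real (a j)"
  have mixed: "e 2 (n + a i + a j) - e 2 (n + a j) - e 2 (n + a i) + e 2 n = - K" if "\<not> q dvd n + a i + a j" for n
  proof -
    have "R (n + a i + a j) = 0"
      by (rule part_count_poly_eq_0[OF R _ _ that]) (use cB k in auto)
    then have shifted: "coeff (pcompose (Q (n + a i + a j)) [:real (a j), 1:]) k = coeff (Q (n + a i)) k"
      using arg_cong[OF rel2[of "n + a i"], of "\<lambda>p. coeff p k"] by simp
    have comm: "n + a i + a j = n + a j + a i" by simp
    have "coeff (pcompose (Q (n + a i + a j)) [:real (a j), 1:]) k = coeff (Q (n + a i + a j)) k +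
        c\<^sub>0 * (real k + 2) * real (a i) * (1 + real k) * real (a j)"
      unfolding comm by (simp add: shiftQ sets Q1)
    moreover have "coeff (Q (n + a i + a j)) k = e 2 (n + a i + a j) - e 2 (n + a j) + K1"
      unfolding comm by (rule Qk)
    ultimately show ?thesis using Qk[of n] shifted
      by (simp add: K_def mult_ac add.commute)
  qed
  have small: "e 2 (n + 2) - 2 * e 2 (n + 1) + e 2 n < K" for n
  proof -
    have "c\<^sub>0 * (e 2 (n + 2) - 2 * e 2 (n + 1) + e 2 n) \<le> c\<^sub>0 * ((real (card I) - 1 - \<alpha>) * c\<^sub>0)"
      using D2[of n] by (simp add: algebra_simps power2_eq_square)
    then have "e 2 (n + 2) - 2 * e 2 (n + 1) + e 2 n \<le> (real (card I) - 1 - \<alpha>) * c\<^sub>0"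
      using c0_pos by (simp only: mult_le_cancel_left_pos)
    \<comment> \<open>Strictness comes from \<alpha> > 0; the remaining factors of \<open>K\<close>
      are at least 1.\<close>
    also have "\<dots> < (real k + 2) * c\<^sub>0"
      using alpha c0_pos by (simp add: k)
    also have "\<dots> = c\<^sub>0 * (real k + 2) * (1 * 1 * 1)" by simp
    also have "\<dots> \<le> c\<^sub>0 * (real k + 2) * ((real k + 1) * real (a i) * real (a j))"
      using ai c0_pos by (intro mult_left_mono mult_mono) auto
    finally show ?thesis by (simp add: K_def mult.assoc)
  qed
  have "K > 0" using c0_pos ai by (simp add: K_def)
  then show False
    using mean_second_difference_not_small[of "e 2" L q "a i" "a j" K] e_periodic L_pos q(1) nd mixed small
    by blast
qed

end

section \<open>The upper bound on the exponent\<close>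

context partition_expansion
begin

text \<open>The ratios of consecutive terms of a log-concave sequence decrease; here their limit is \<open>1\<close>,
  so they are all at least \<open>1\<close>.\<close>

lemma eventually_increasing:
  assumes lc: "\<forall>\<^sub>F n in sequentially. log_concave_at \<alpha> n" and alpha: "\<alpha> \<ge> real (card I) - 1"
  obtains N where "N > 0" "\<And>n. n \<ge> N \<Longrightarrow> u n < u (n + 1)" "\<And>n. n \<ge> N \<Longrightarrow> part_count a I n > 0"
proof -
  define g where "g n = real (part_count a I n) / real n powr \<alpha>" for n
  have "\<forall>\<^sub>F n in sequentially. log_concave_at \<alpha> n \<and> part_count a I n > 0 \<and> n > 0"
    by (intro eventually_conj lc eventually_positive[OF lc] eventually_gt_at_top)
  then obtain N where N: "\<And>n. n \<ge> N \<Longrightarrow> log_concave_at \<alpha> n \<and> part_count a I n > 0 \<and> n > 0"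
    by (auto simp: eventually_sequentially)
  have N0: "N > 0" using N[of N] by simp
  have g_pos: "g n > 0" if "n \<ge> N" for n using N[OF that] by (simp add: g_def)
  have g_lc: "g (n + 2) * g n < g (n + 1) ^ 2" if "n \<ge> N" for n
    using N[OF that] by (simp only: log_concave_at_def g_def)
  have g_u: "g n = u n * real n powr (real (card I) - 1 - \<alpha>)" if "n > 0" for n
  proof -
    have "real n powr (real (card I) - 1 - \<alpha>) = real n ^ (card I - 1) / real n powr \<alpha>"
      using that k_pos by (simp add: powr_diff of_nat_diff flip: powr_realpow)
    then show ?thesis using that by (simp add: g_def u_def)
  qed
  define r where "r m = g (N + m + 1) / g (N + m)" for m
  have r_less: "r (Suc m) < r m" for m
    using g_lc[of "N + m"] g_pos[of "N + m"] g_pos[of "N + m + 1"]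
    by (simp add: r_def divide_simps power2_eq_square)
  have u_lim: "u \<longlonglongrightarrow> c\<^sub>0"
    by (rule u_tendsto) (rule e0_eq, rule card_divisible_less[OF lc])
  have "filterlim (\<lambda>m. N + m) at_top sequentially" "filterlim (\<lambda>m. N + m + 1) at_top sequentially"
    by (rule filterlim_at_top_mono[OF filterlim_ident]; simp)+
  then have "(\<lambda>m. u (N + m + 1) / u (N + m)) \<longlonglongrightarrow> c\<^sub>0 / c\<^sub>0"
    using c0_pos by (intro tendsto_divide filterlim_compose[OF u_lim]) auto
  moreover have "(\<lambda>m. ((real N + real m + 1) / (real N + real m)) powr (real (card I) - 1 - \<alpha>)) \<longlonglongrightarrow> 1"
  proof -
    have "(\<lambda>m. (real N + real m + 1) / (real N + real m)) \<longlonglongrightarrow> 1" by real_asymp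
    then have "(\<lambda>m. ((real N + real m + 1) / (real N + real m)) powr (real (card I) - 1 - \<alpha>)) \<longlonglongrightarrow> 1 powr (real (card I) - 1 - \<alpha>)"
      by (intro tendsto_powr tendsto_const) auto
    then show ?thesis by simp
  qed
  ultimately have "(\<lambda>m. (u (N + m + 1) / u (N + m)) * ((real N + real m + 1) / (real N + real m)) powr (real (card I) - 1 - \<alpha>)) \<longlonglongrightarrow> c\<^sub>0 / c\<^sub>0 * 1"
    by (rule tendsto_mult)
  moreover have "(u (N + m + 1) / u (N + m)) * ((real N + real m + 1) / (real N + real m)) powr (real (card I) - 1 - \<alpha>) = r m" for m
    using N0 by (simp add: r_def g_u powr_divide add_ac)
  ultimately have r_lim: "r \<longlonglongrightarrow> 1" using c0_pos by simp
  have "decseq r" using r_less by (intro decseq_SucI less_imp_le)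
  then have r_ge: "r m \<ge> 1" for m using r_lim by (rule decseq_ge)
  have g_less: "g n < g (n + 1)" if "n \<ge> N" for n
  proof -
    \<comment> \<open>A strictly decreasing sequence stays strictly above its limit.\<close>
    have "1 < r (n - N)" using r_ge[of "Suc (n - N)"] r_less[of "n - N"] by linarith
    then show ?thesis using that g_pos[OF that] by (simp add: r_def)
  qed
  have "u n < u (n + 1)" if "n \<ge> N" for n
  proof -
    define b where "b = \<alpha> - (real (card I) - 1)"
    have u_g: "u m = g m * real m powr b" if "m > 0" for m
      using g_u[OF that] that by (simp add: b_def flip: powr_add)
    have n: "n > 0" using that N0 by simp
    have "g n * real n powr b < g (n + 1) * real n powr b"
      using g_less[OF that] n by simp
    also have "\<dots> \<le> g (n + 1) * real (n + 1) powr b"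
      using g_pos[of "n + 1"] that alpha by (intro mult_left_mono powr_mono2) (auto simp: b_def)
    finally show ?thesis using u_g n by simp
  qed
  then show ?thesis using that[of N] N0 N by blast
qed

lemma log_concave_imp_less:
  assumes lc: "\<forall>\<^sub>F n in sequentially. log_concave_at \<alpha> n"
  shows "\<alpha> < real (card I) - 1"
proof (rule ccontr)
  assume "\<not> \<alpha> < real (card I) - 1"
  then obtain N where N: "N > 0" "\<And>n. n \<ge> N \<Longrightarrow> u n < u (n + 1)" "\<And>n. n \<ge> N \<Longrightarrow> part_count a I n > 0"
    using eventually_increasing[OF lc] by (metis linorder_not_less)
  have "u \<longlonglongrightarrow> c\<^sub>0"
    by (rule u_tendsto) (rule e0_eq, rule card_divisible_less[OF lc])
  then have u_lim: "(\<lambda>m. u (m + N)) \<longlonglongrightarrow> c\<^sub>0" by (rule LIMSEQ_ignore_initial_segment)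
  have "incseq (\<lambda>m. u (m + N))" by (rule incseq_SucI) (use N(2) in \<open>auto intro: less_imp_le\<close>)
  then have "u (m + N) \<le> c\<^sub>0" for m using u_lim by (rule incseq_le)
  then have u_le: "u n \<le> c\<^sub>0" if "n \<ge> N" for n using that by (metis le_add_diff_inverse2)
  show False
  proof (cases "card I = 1")
    case True
    \<comment> \<open>With a single part \<open>u\<close> is the count itself: at least 1 at
      \<open>N\<close>, strictly larger next, yet at most \<open>c\<^sub>0 \<le> 1\<close>.\<close>
    have "(\<Prod>i\<in>I. 1) \<le> (\<Prod>i\<in>I. real (a i))"
      by (intro prod_mono) (use pos in \<open>auto simp: Suc_le_eq\<close>)
    then have "c\<^sub>0 \<le> 1" using True by (simp add: c\<^sub>0_def divide_le_eq_1)
    moreover have "u N = real (part_count a I N)" unfolding u_def by (simp add: True)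
    then have "u N \<ge> 1" using N(3)[of N] by simp
    ultimately show False using N(2)[of N] u_le[of "N + 1"] by simp
  next
    case False
    then have k2: "card I \<ge> 2" using k_pos by linarith
    define k where "k = card I"
    \<comment> \<open>The excess of the cumulative count over the simplex volume: never negative,
      but from \<open>N\<close> on the bound on \<open>u\<close> costs it at least
      \<open>c\<^sub>0 / k\<close> per step.\<close>
    define D where "D n = (\<Sum>m\<le>n. real (part_count a I m)) - c\<^sub>0 / real k * real (n + 1) ^ k" for n
    have kk: "(fact k :: real) = real k * fact (k - 1)" using k2 by (simp add: k_def fact_reduce)
    have D_nonneg: "D n \<ge> 0" for n
      using sum_part_count_ge[of I a n] fin pos by (simp add: D_def c\<^sub>0_def k_def[symmetric] kk mult_ac)
    have D_step: "D (Suc n) \<le> D n - c\<^sub>0 / real k" if n: "Suc n \<ge> N" for n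
    proof -
      define x where "x = real (Suc n)"
      have "real (part_count a I (Suc n)) = u (Suc n) * x ^ (k - 1)" by (simp add: u_def x_def k_def)
      also have "\<dots> \<le> c\<^sub>0 * x ^ (k - 1)" using u_le[OF n] by (intro mult_right_mono) (auto simp: x_def)
      finally have 1: "real (part_count a I (Suc n)) \<le> c\<^sub>0 * x ^ (k - 1)" .
      have "x ^ k + real k * x ^ (k - 1) + 1 \<le> (x + 1) ^ k"
        by (rule power_Suc_ge_with_remainder) (use k2 in \<open>auto simp: x_def k_def\<close>)
      then have "c\<^sub>0 / real k * (x ^ k + real k * x ^ (k - 1) + 1) \<le> c\<^sub>0 / real k * (x + 1) ^ k"
        using c0_pos by (intro mult_left_mono) auto
      moreover have "c\<^sub>0 / real k * (x ^ k + real k * x ^ (k - 1) + 1) = c\<^sub>0 / real k * x ^ k + c\<^sub>0 * x ^ (k - 1) + c\<^sub>0 / real k"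
        using k2 by (simp add: k_def distrib_left)
      moreover have "D (Suc n) = D n + real (part_count a I (Suc n)) + c\<^sub>0 / real k * x ^ k - c\<^sub>0 / real k * (x + 1) ^ k"
        by (simp add: D_def x_def add_ac)
      ultimately show ?thesis using 1 by linarith
    qed
    have D_le: "D (N + m) \<le> D N - real m * (c\<^sub>0 / real k)" for m
    proof (induction m)
      case (Suc m)
      then show ?case using D_step[of "N + m"] by (simp add: algebra_simps add_divide_distrib)
    qed simp
    have "c\<^sub>0 / real k > 0" using c0_pos k2 by (simp add: k_def)
    then obtain m where "D N < real m * (c\<^sub>0 / real k)" using reals_Archimedean3 by blast
    then show False using D_le[of m] D_nonneg[of "N + m"] by linarith
  qed
qed

lemma eventually_log_concave_iff:
  assumes "\<alpha> > 0"
  shows "(\<forall>\<^sub>F n in sequentially. log_concave_at \<alpha> n) \<longleftrightarrow>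
    \<alpha> < real (card I) - 1 \<and> (\<forall>d\<ge>2. card (divisible d) \<le> card I - 3)"
proof (intro iffI conjI allI impI)
  assume lc: "\<forall>\<^sub>F n in sequentially. log_concave_at \<alpha> n"
  show less: "\<alpha> < real (card I) - 1" by (rule log_concave_imp_less[OF lc])
  fix d :: nat assume d: "d \<ge> 2"
  have k2: "card I \<ge> 2" using less assms by linarith
  show "card (divisible d) \<le> card I - 3"
  proof (cases "card I = 2")
    case True
    \<comment> \<open>For two parts the truncated \<open>card I - 3\<close> equals
      \<open>card I - 2 = 0\<close>.\<close>
    then show ?thesis using card_divisible_le_minus_2[OF lc k2 d] by simp
  next
    case False
    then show ?thesis using card_divisible_le_minus_3[OF lc _ d assms] k2 by simp
  qed
qed (use eventually_log_concave_if in blast)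

end

section \<open>From divisibility counts to gcds of subsets\<close>

text \<open>Either side fails exactly when some \<open>m\<close> indices carry parts with a common
  divisor \<open>d \<ge> 2\<close>. Positivity of \<open>m\<close> keeps out the empty set, whose
  \<open>Gcd\<close> is 0.\<close>

lemma Gcd_subsets_iff_card_divisible:
  fixes a :: "'i \<Rightarrow> nat"
  assumes "finite I" "\<And>i. i \<in> I \<Longrightarrow> a i > 0" "0 < m" "m \<le> card I"
  shows "(\<forall>S. S \<subseteq> I \<and> card S = m \<longrightarrow> Gcd (a ` S) = 1) \<longleftrightarrow> (\<forall>d\<ge>2. card {i \<in> I. d dvd a i} < m)"
proof (intro iffI allI impI)
  fix d :: nat assume G: "\<forall>S. S \<subseteq> I \<and> card S = m \<longrightarrow> Gcd (a ` S) = 1" and d: "d \<ge> 2"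
  show "card {i \<in> I. d dvd a i} < m"
  proof (rule ccontr)
    assume "\<not> card {i \<in> I. d dvd a i} < m"
    then obtain S where S: "S \<subseteq> {i \<in> I. d dvd a i}" "card S = m"
      by (metis linorder_not_less obtain_subset_with_card_n)
    then have "d dvd Gcd (a ` S)" by (auto intro: Gcd_greatest)
    moreover have "Gcd (a ` S) = 1" using G S by auto
    ultimately show False using d by simp
  qed
next
  fix S assume D: "\<forall>d\<ge>2. card {i \<in> I. d dvd a i} < m" and S: "S \<subseteq> I \<and> card S = m"
  obtain s where s: "s \<in> S" using S assms(3) by fastforce
  show "Gcd (a ` S) = 1"
  proof (rule ccontr)
    assume "Gcd (a ` S) \<noteq> 1"
    moreover have "a s \<noteq> 0" using s S assms(2)[of s] by auto
    then have "Gcd (a ` S) \<noteq> 0" using s by (auto simp: Gcd_0_iff image_subset_iff)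
    ultimately have "Gcd (a ` S) \<ge> 2" by linarith
    then have "card {i \<in> I. Gcd (a ` S) dvd a i} < m" using D by blast
    moreover have "card S \<le> card {i \<in> I. Gcd (a ` S) dvd a i}"
      using S assms(1) by (intro card_mono) (auto intro: Gcd_dvd)
    ultimately show False using S by simp
  qed
qed

theorem theorem3p5:
  fixes a :: "nat \<Rightarrow> nat" and k :: nat and \<alpha> :: real
  assumes mono_a: "\<And>i j. 1 \<le> i \<Longrightarrow> i \<le> j \<Longrightarrow> a i \<le> a j"
    and pos_a: "\<And>i. 1 \<le> i \<Longrightarrow> a i > 0"
    and k_pos: "k > 0"
    and alpha_pos: "\<alpha> > 0"
  shows "(\<exists>N::nat. \<forall>n\<ge>N.
            (real (restricted_partition a n k) / real n powr \<alpha>) ^ 2 >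
            (real (restricted_partition a (n + 1) k) / real (n + 1) powr \<alpha>) *
            (real (restricted_partition a (n - 1) k) / real (n - 1) powr \<alpha>))
         \<longleftrightarrow>
         (real k > \<alpha> + 1 \<and>
          ((2 \<le> k \<and> k \<le> 3 \<and> (\<forall>i\<in>{1..k}. a i = 1)) \<or>
           (k \<ge> 4 \<and> (\<forall>S. S \<subseteq> {1..k} \<and> card S = k - 2 \<longrightarrow> Gcd (a ` S) = 1))))"
proof -
  define L where "L = (\<Prod>i\<in>{1..k}. a i)"
  have L: "L > 0" unfolding L_def using pos_a by (intro prod_pos) auto
  have dvd: "a i dvd L" if "i \<in> {1..k}" for i unfolding L_def using that by (intro dvd_prodI) auto
  obtain P where P: "quasi_poly L (\<lambda>n. real (part_count a {1..k} n)) P"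
      "\<forall>n. \<forall>j\<ge>card {1..k}. coeff (P n) j = 0"
    using exists_quasi_poly_part_count[of "{1..k}" a L] pos_a dvd L by auto
  interpret partition_expansion a "{1..k}" L P
    using pos_a dvd L P k_pos by unfold_locales auto
  have "(\<exists>N::nat. \<forall>n\<ge>N.
            (real (restricted_partition a n k) / real n powr \<alpha>) ^ 2 >
            (real (restricted_partition a (n + 1) k) / real (n + 1) powr \<alpha>) *
            (real (restricted_partition a (n - 1) k) / real (n - 1) powr \<alpha>))
      \<longleftrightarrow> (\<forall>\<^sub>F n in sequentially. log_concave_at \<alpha> n)"
    unfolding eventually_sequentially[symmetric] log_concave_at_def restricted_partition_eq_part_count
    \<comment> \<open>Moving the index to \<open>Suc n\<close> turns the truncated
      \<open>n - 1\<close> into \<open>n\<close>.\<close>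
    by (subst eventually_sequentially_Suc[symmetric]) simp
  also have "\<dots> \<longleftrightarrow> \<alpha> < real k - 1 \<and> (\<forall>d\<ge>2. card (divisible d) \<le> k - 3)"
    using eventually_log_concave_iff[OF alpha_pos] by simp
  also have "\<dots> \<longleftrightarrow> (real k > \<alpha> + 1 \<and>
          ((2 \<le> k \<and> k \<le> 3 \<and> (\<forall>i\<in>{1..k}. a i = 1)) \<or>
           (k \<ge> 4 \<and> (\<forall>S. S \<subseteq> {1..k} \<and> card S = k - 2 \<longrightarrow> Gcd (a ` S) = 1))))"
  proof (cases "k \<ge> 4")
    case True
    then have "card {i \<in> {1..k}. d dvd a i} \<le> k - 3 \<longleftrightarrow> card {i \<in> {1..k}. d dvd a i} < k - 2" for d
      by linarith
    moreover have "(\<forall>S. S \<subseteq> {1..k} \<and> card S = k - 2 \<longrightarrow> Gcd (a ` S) = 1) \<longleftrightarrow> (\<forall>d\<ge>2. card {i \<in> {1..k}. d dvd a i} < k - 2)"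
      by (rule Gcd_subsets_iff_card_divisible) (use True pos_a in auto)
    ultimately have "(\<forall>d\<ge>2. card (divisible d) \<le> k - 3) \<longleftrightarrow> (\<forall>S. S \<subseteq> {1..k} \<and> card S = k - 2 \<longrightarrow> Gcd (a ` S) = 1)"
      by (simp only: divisible_def)
    then show ?thesis using True by (simp only:) auto
  next
    case False
    \<comment> \<open>Here the truncated \<open>k - 3\<close> is 0: no \<open>d \<ge> 2\<close>
      divides any part, so all parts are 1.\<close>
    then have k3: "k - 3 = 0" "k \<le> 3" by auto
    have ones: "(\<forall>d\<ge>2. card (divisible d) \<le> 0) \<longleftrightarrow> (\<forall>i\<in>{1..k}. a i = 1)"
    proof
      assume D: "\<forall>d\<ge>2. card (divisible d) \<le> 0"
      show "\<forall>i\<in>{1..k}. a i = 1"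
      proof (rule ballI, rule ccontr)
        fix i assume i: "i \<in> {1..k}" "a i \<noteq> 1"
        then have "a i \<ge> 2" using pos_a[of i] by auto
        then have "card (divisible (a i)) = 0" using D le_0_eq by blast
        moreover have "finite (divisible (a i))" unfolding divisible_def by simp
        ultimately have "divisible (a i) = {}" by (simp only: card_0_eq)
        moreover have "i \<in> divisible (a i)" unfolding divisible_def using i(1) by simp
        ultimately show False by simp
      qed
    next
      assume one: "\<forall>i\<in>{1..k}. a i = 1"
      show "\<forall>d\<ge>2. card (divisible d) \<le> 0"
      proof (intro allI impI)
        fix d :: nat assume "d \<ge> 2"
        then have "\<not> d dvd 1" by simp
        then have "divisible d = {}" unfolding divisible_def using one using \<open>\<not> d dvd 1\<close> by fastforce
        then show "card (divisible d) \<le> 0" by simp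
      qed
    qed
    show ?thesis
    proof (cases "\<alpha> < real k - 1")
      case True
      then have "real k > \<alpha> + 1" by linarith
      moreover from this have "real k > 1" using alpha_pos by linarith
      then have "2 \<le> k" by simp
      ultimately show ?thesis unfolding k3 ones using True k3 by simp
    next
      case False
      then have "\<not> real k > \<alpha> + 1" by linarith
      then show ?thesis using False by simp
    qed
  qed
  finally show ?thesis .
qed

end
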